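(* For every prime $p$ such that $p\equiv 1\pmod 4$ or $p\equiv 1\pmod 6$, the group $Q_8\times\mathbb{Z}_p$ is not a Schur group.
   Context: Notation: $\mathbb{Z}_n$ is the cyclic group of order $n$; $Q_8$ is the quaternion group of order $8$. Let $G$ be a finite group with identity $e$. For $X\subseteq G$ put $\underline{X}=\sum_{x\in X}x\in\mathbb{Z}G$ and $X^{-1}=\{x^{-1}:x\in X\}$. A subring $\mathcal{A}\subseteq\mathbb{Z}G$ is an S-ring over $G$ if there is a partition $\mathcal{S}$ of $G$ such that (1) $\{e\}\in\mathcal{S}$; (2) $X\in\mathcal{S}$ implies $X^{-1}\in\mathcal{S}$; (3) $\mathcal{A}=\mathrm{Span}_{\mathbb{Z}}\{\underline{X}:X\in\mathcal{S}\}$. Let $G_r\leq\mathrm{Sym}(G)$ be the group of right translations of $G$. For $K\leq \mathrm{Sym}(G)$ with $K\geq G_r$, the $\mathbb{Z}$-module $V(K,G)=\mathrm{Span}_{\mathbb{Z}}\{\underline{X}: X \text{ is an orbit of } K_e \text{ on } G\}$, where $K_e$ is the stabilizer of $e$ in $K$, is an S-ring over $G$. An S-ring $\mathcal{A}$ over $G$ is schurian if $\mathcal{A}=V(K,G)$ for some $K$ with $G_r\leq K\leq\mathrm{Sym}(G)$. The group $G$ is a Schur group if every S-ring over $G$ is schurian. *)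

theory Defs
  imports
    "HOL-Algebra.Elementary_Groups"
    "HOL-Algebra.Group_Action"
    "HOL-Algebra.Subrings"
    "HOL-Library.Disjoint_Sets"
    "HOL-Library.Indicator_Function"
    "HOL-Number_Theory.Cong"
    "HOL-Computational_Algebra.Primes"
begin

section \<open>The integral group ring\<close>

text \<open>For a finite group, an element of the group ring is its coefficient function, extended by
  zero outside the carrier, and the product is convolution. In this model the simple quantity of a
  set of group elements is its integer-valued \<^const>\<open>indicator\<close> function.\<close>

definition group_ring :: "('a, 'b) monoid_scheme \<Rightarrow> ('a \<Rightarrow> int) ring" where
  "group_ring G =
    \<lparr>carrier = {f. \<forall>x. x \<notin> carrier G \<longrightarrow> f x = 0},
     monoid.mult = (\<lambda>f g x. if x \<in> carrier G
               then \<Sum>y\<in>carrier G. f y * g (inv\<^bsub>G\<^esub> y \<otimes>\<^bsub>G\<^esub> x) else 0),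
     one = indicator {\<one>\<^bsub>G\<^esub>},
     ring.zero = (\<lambda>x. 0),
     ring.add = (\<lambda>f g x. f x + g x)\<rparr>"

definition int_span :: "('a \<Rightarrow> int) set \<Rightarrow> ('a \<Rightarrow> int) set" where
  "int_span B = {(\<lambda>x. \<Sum>b\<in>T. c b * b x) | T c. finite T \<and> T \<subseteq> B}"

lemma ring_group_ring:
  fixes G (structure)
  assumes "group G" and fin: "finite (carrier G)"
  shows "ring (group_ring G)"
proof -
  interpret group G by fact
  show ?thesis
  proof (rule ringI)
    show "abelian_group (group_ring G)"
    proof (rule abelian_groupI)
      fix f assume "f \<in> carrier (group_ring G)"
      then show "\<exists>g\<in>carrier (group_ring G). g \<oplus>\<^bsub>group_ring G\<^esub> f = \<zero>\<^bsub>group_ring G\<^esub>"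
        by (intro bexI[of _ "\<lambda>x. - f x"]) (auto simp: group_ring_def)
    qed (auto simp: group_ring_def)
  next
    show "monoid (group_ring G)"
    proof (rule monoidI)
      fix f assume f: "f \<in> carrier (group_ring G)"
      have "(\<Sum>y\<in>carrier G. indicator {\<one>} y * f (inv y \<otimes> x)) = f x"
        if "x \<in> carrier G" for x
      proof -
        have "(\<Sum>y\<in>carrier G. indicator {\<one>} y * f (inv y \<otimes> x))
            = (\<Sum>y\<in>carrier G. if y = \<one> then f (inv y \<otimes> x) else 0)"
          by (intro sum.cong) auto
        then show ?thesis using that fin by (simp add: sum.delta)
      qed
      then show "\<one>\<^bsub>group_ring G\<^esub> \<otimes>\<^bsub>group_ring G\<^esub> f = f"
        using f by (auto simp: group_ring_def)
      have "(\<Sum>y\<in>carrier G. f y * indicator {\<one>} (inv y \<otimes> x)) = f x"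
        if "x \<in> carrier G" for x
      proof -
        have "(\<Sum>y\<in>carrier G. f y * indicator {\<one>} (inv y \<otimes> x))
            = (\<Sum>y\<in>carrier G. if y = x then f y else 0)"
        proof (intro sum.cong refl)
          fix y assume "y \<in> carrier G"
          then have "inv y \<otimes> x = \<one> \<longleftrightarrow> y = x"
            using that by (metis inv_closed inv_equality inv_inv l_inv)
          then show "f y * indicator {\<one>} (inv y \<otimes> x) = (if y = x then f y else 0)"
            by (auto simp: indicator_def)
        qed
        then show ?thesis using that fin by (simp add: sum.delta)
      qed
      then show "f \<otimes>\<^bsub>group_ring G\<^esub> \<one>\<^bsub>group_ring G\<^esub> = f"
        using f by (auto simp: group_ring_def)
    next
      fix f g h assume "f \<in> carrier (group_ring G)" "g \<in> carrier (group_ring G)"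
        "h \<in> carrier (group_ring G)"
      have "(\<Sum>y\<in>carrier G. (\<Sum>z\<in>carrier G. f z * g (inv z \<otimes> y)) * h (inv y \<otimes> x))
          = (\<Sum>z\<in>carrier G. f z * (\<Sum>y\<in>carrier G. g y * h (inv y \<otimes> (inv z \<otimes> x))))"
        if x: "x \<in> carrier G" for x
      proof -
        have "(\<Sum>y\<in>carrier G. (\<Sum>z\<in>carrier G. f z * g (inv z \<otimes> y)) * h (inv y \<otimes> x))
            = (\<Sum>z\<in>carrier G. f z * (\<Sum>y\<in>carrier G. g (inv z \<otimes> y) * h (inv y \<otimes> x)))"
          unfolding sum_distrib_left sum_distrib_right
          by (subst sum.swap) (simp add: mult.assoc)
        also have "\<dots> = (\<Sum>z\<in>carrier G. f z *
            (\<Sum>y\<in>carrier G. g y * h (inv y \<otimes> (inv z \<otimes> x))))"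
        proof (rule sum.cong[OF refl], rule arg_cong2[where f = "(*)", OF refl])
          fix z assume z: "z \<in> carrier G"
          have canc: "z \<otimes> (inv z \<otimes> w) = w" "inv z \<otimes> (z \<otimes> w) = w"
            if "w \<in> carrier G" for w
            using z that by (simp_all flip: m_assoc)
          show "(\<Sum>y\<in>carrier G. g (inv z \<otimes> y) * h (inv y \<otimes> x))
              = (\<Sum>y\<in>carrier G. g y * h (inv y \<otimes> (inv z \<otimes> x)))"
            by (rule sum.reindex_bij_witness[of _ "\<lambda>y. z \<otimes> y" "\<lambda>y. inv z \<otimes> y"])
              (use x z canc in \<open>auto simp: inv_mult_group m_assoc\<close>)
        qed
        finally show ?thesis .
      qed
      then show "f \<otimes>\<^bsub>group_ring G\<^esub> g \<otimes>\<^bsub>group_ring G\<^esub> h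
          = f \<otimes>\<^bsub>group_ring G\<^esub> (g \<otimes>\<^bsub>group_ring G\<^esub> h)"
        by (auto simp: group_ring_def fun_eq_iff cong: sum.cong)
    qed (auto simp: group_ring_def indicator_def)
  qed (auto simp: group_ring_def fun_eq_iff distrib_left distrib_right sum.distrib)
qed


section \<open>S-rings and Schur groups\<close>

definition s_ring :: "('a, 'b) monoid_scheme \<Rightarrow> ('a \<Rightarrow> int) set \<Rightarrow> bool" where
  "s_ring G \<A> \<longleftrightarrow> subring \<A> (group_ring G) \<and>
    (\<exists>\<S>. partition_on (carrier G) \<S> \<and> {\<one>\<^bsub>G\<^esub>} \<in> \<S> \<and>
         (\<forall>X\<in>\<S>. m_inv G ` X \<in> \<S>) \<and> \<A> = int_span (indicator ` \<S>))"

definition right_translations :: "('a, 'b) monoid_scheme \<Rightarrow> ('a \<Rightarrow> 'a) set" where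
  "right_translations G = (\<lambda>g. \<lambda>x\<in>carrier G. x \<otimes>\<^bsub>G\<^esub> g) ` carrier G"

text \<open>Permutations act by evaluation, hence the action argument \<^term>\<open>\<lambda>f. f\<close>.\<close>

definition transitivity_module ::
    "('a \<Rightarrow> 'a) set \<Rightarrow> ('a, 'b) monoid_scheme \<Rightarrow> ('a \<Rightarrow> int) set" where
  "transitivity_module K G =
    (let Sym = BijGroup (carrier G);
         K\<^sub>e = stabilizer (Sym\<lparr>carrier := K\<rparr>) (\<lambda>f. f) \<one>\<^bsub>G\<^esub>
     in int_span (indicator ` orbits (Sym\<lparr>carrier := K\<^sub>e\<rparr>) (carrier G) (\<lambda>f. f)))"

definition schurian :: "('a, 'b) monoid_scheme \<Rightarrow> ('a \<Rightarrow> int) set \<Rightarrow> bool" where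
  "schurian G \<A> \<longleftrightarrow> (\<exists>K. subgroup K (BijGroup (carrier G)) \<and> right_translations G \<subseteq> K \<and>
    \<A> = transitivity_module K G)"

text \<open>Intended for finite groups; being a finite group is deliberately not a conjunct, so that the
  negation says exactly that some S-ring is not schurian.\<close>

definition schur_group :: "('a, 'b) monoid_scheme \<Rightarrow> bool" where
  "schur_group G \<longleftrightarrow> (\<forall>\<A>. s_ring G \<A> \<longrightarrow> schurian G \<A>)"


section \<open>The quaternion group of order 8\<close>

datatype quat_unit = Q1 | Qi | Qj | Qk

fun quat_unit_mult :: "quat_unit \<Rightarrow> quat_unit \<Rightarrow> int \<times> quat_unit" where
  "quat_unit_mult Q1 v = (1, v)"
| "quat_unit_mult u Q1 = (1, u)"
| "quat_unit_mult Qi Qi = (-1, Q1)"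
| "quat_unit_mult Qj Qj = (-1, Q1)"
| "quat_unit_mult Qk Qk = (-1, Q1)"
| "quat_unit_mult Qi Qj = (1, Qk)"
| "quat_unit_mult Qj Qk = (1, Qi)"
| "quat_unit_mult Qk Qi = (1, Qj)"
| "quat_unit_mult Qj Qi = (-1, Qk)"
| "quat_unit_mult Qk Qj = (-1, Qi)"
| "quat_unit_mult Qi Qk = (-1, Qj)"

text \<open>The pair of a sign \<open>s\<close> and a unit \<open>u\<close> stands for the quaternion \<open>s u\<close>.\<close>

definition Q8 :: "(int \<times> quat_unit) monoid" where
  "Q8 = \<lparr>carrier = {1, -1} \<times> UNIV,
         monoid.mult = (\<lambda>(s, u) (t, v). case quat_unit_mult u v of (r, w) \<Rightarrow> (s * t * r, w)),
         one = (1, Q1)\<rparr>"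

lemma UNIV_quat_unit: "UNIV = {Q1, Qi, Qj, Qk}"
  using quat_unit.exhaust by auto

lemma order_Q8: "order Q8 = 8"
  by (simp add: order_def Q8_def UNIV_quat_unit card_cartesian_product)

lemma group_Q8: "group Q8"
proof (rule groupI)
  fix x y assume "x \<in> carrier Q8" "y \<in> carrier Q8"
  then show "x \<otimes>\<^bsub>Q8\<^esub> y \<in> carrier Q8"
    by (cases "snd x"; cases "snd y") (auto simp: Q8_def)
next
  fix x y z assume "x \<in> carrier Q8" "y \<in> carrier Q8" "z \<in> carrier Q8"
  show "x \<otimes>\<^bsub>Q8\<^esub> y \<otimes>\<^bsub>Q8\<^esub> z = x \<otimes>\<^bsub>Q8\<^esub> (y \<otimes>\<^bsub>Q8\<^esub> z)"
    by (cases x; cases y; cases z; cases "snd x"; cases "snd y"; cases "snd z")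
      (simp_all add: Q8_def)
next
  fix x assume x: "x \<in> carrier Q8"
  obtain s u where su: "x = (s, u)" by (cases x)
  show "\<exists>y\<in>carrier Q8. y \<otimes>\<^bsub>Q8\<^esub> x = \<one>\<^bsub>Q8\<^esub>"
    by (rule bexI[of _ "(if u = Q1 then s else - s, u)"])
      (use x in \<open>cases u; auto simp: su Q8_def\<close>)+
qed (auto simp: Q8_def)

lemma group_Q8_times_integer_mod_group: "group (Q8 \<times>\<times> integer_mod_group n)"
  by (intro DirProd_group group_Q8 group_integer_mod_group)

lemma finite_Q8_times_integer_mod_group:
  "n > 0 \<Longrightarrow> finite (carrier (Q8 \<times>\<times> integer_mod_group n))"
  by (simp add: carrier_integer_mod_group Q8_def UNIV_quat_unit)

end

theory Submission
  imports
    Defs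
    "HOL-Number_Theory.Residue_Primitive_Roots"
    "HOL-Computational_Algebra.Polynomial"
begin

text \<open>Put \<open>r = 2\<close> if 4 divides \<open>p - 1\<close> and \<open>r = 3\<close> if 6 divides \<open>p - 1\<close>, and let \<open>g\<close> be a primitive
  root modulo \<open>p\<close>. Take \<open>r\<close> imaginary units of \<open>Q\<^sub>8\<close>, namely \<open>j, k\<close> or \<open>i, j, k\<close>, and attach to
  them the multiplicative translates by powers of \<open>g\<close> of one function \<open>f\<close> from the nonzero residues
  to \<open>\<plusminus>1\<close> such that \<open>f (g\<^sup>r t) = - f t\<close>; attach the opposite functions to the negatives of the
  units. The level sets of the resulting function \<open>\<phi>\<close> on \<open>Q\<^sub>8 \<times> Z\<^sub>p\<close>, refined only by the obvious
  invariant sets, form an S-ring: imaginary units anticommute, so all mixed terms of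
  \<open>\<phi> * \<phi>\<close> cancel, and the remaining sum of autocorrelations is invariant under \<open>g\<close>.

  If the S-ring were schurian, then, as both factors are unions of basic sets and \<open>{i, -i}\<close> lies in
  one basic set, there would be a permutation
  \<open>\<pi> \<times> \<rho>\<close> of \<open>Q\<^sub>8 \<times> Z\<^sub>p\<close> respecting the S-ring, fixing the identity and taking \<open>i\<close> to \<open>-i\<close>. By
  Mueller's lemma behind Burnside's theorem on groups of prime degree, \<open>\<rho>\<close> is multiplication by
  some \<open>g\<^sup>e\<close>. Hence \<open>\<pi>\<close> acts on the \<open>2 r\<close> signed units as a power of a \<open>2 r\<close>-cycle; but \<open>\<pi>\<close> must also
  respect products, and no such power does so while sending \<open>i\<close> to \<open>-i\<close>.\<close>

section \<open>Permutations of a prime field preserving a difference set\<close>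

lemma pcompose_monom:
  fixes r :: "'a::comm_semiring_1 poly"
  shows "pcompose (monom c i) r = smult c (r ^ i)"
  by (induction i) (simp_all add: monom_0 monom_Suc pcompose_pCons)

lemma coeff_pcompose_shift:
  fixes q :: "'a::comm_semiring_1 poly"
  assumes "degree q \<le> N"
  shows "coeff (pcompose q [:u, 1:]) k = (\<Sum>i=k..N. coeff q i * (of_nat (i choose k) * u ^ (i - k)))"
proof -
  have lin: "coeff ([:u, 1:] ^ i) k = (if k \<le> i then of_nat (i choose k) * u ^ (i - k) else 0)" for i
  proof (cases "k \<le> i")
    case False
    have "degree ([:u, 1:] ^ i) \<le> i"
      using degree_power_le[of "[:u, 1:]" i] by (auto split: if_splits)
    then show ?thesis using False by (simp add: coeff_eq_0)
  qed (simp add: coeff_linear_poly_power)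
  have "pcompose q [:u, 1:] = pcompose (\<Sum>i\<le>N. monom (coeff q i) i) [:u, 1:]"
    using poly_as_sum_of_monoms'[OF assms] by simp
  also have "\<dots> = (\<Sum>i\<le>N. smult (coeff q i) ([:u, 1:] ^ i))"
    by (simp add: pcompose_sum pcompose_monom)
  finally have "coeff (pcompose q [:u, 1:]) k = (\<Sum>i\<le>N. coeff q i * coeff ([:u, 1:] ^ i) k)"
    by (simp add: coeff_sum)
  also have "\<dots> = (\<Sum>i=k..N. coeff q i * (of_nat (i choose k) * u ^ (i - k)))"
    by (rule sum.mono_neutral_cong_right) (auto simp: lin)
  finally show ?thesis .
qed

text \<open>The forward difference \<open>D\<close> still vanishes modulo \<open>p\<close>, has a
  degree bound lower by one, and its new top coefficient is the old one times \<open>Suc d\<close>,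
  which is prime to \<open>p\<close> because \<open>Suc d < p\<close>.\<close>

lemma top_coeff_dvd_of_vanishing:
  fixes q :: "int poly"
  assumes "prime p" "degree q \<le> d" "d < p" "\<And>x. int p dvd poly q x"
  shows "int p dvd coeff q d"
  using assms(2-)
proof (induction d arbitrary: q)
  case 0
  have "poly q 0 = coeff q 0" by (simp add: poly_0_coeff_0)
  with 0(3)[of 0] show ?case by simp
next
  case (Suc d)
  define D where "D = pcompose q [:1, 1:] - q"
  have cD: "coeff D k = (\<Sum>i=k..Suc d. coeff q i * int (i choose k)) - coeff q k" for k
    using coeff_pcompose_shift[OF Suc.prems(1), of 1 k] by (simp add: D_def)
  have "coeff D k = 0" if "k > d" for k
    using that Suc.prems(1) by (cases "k = Suc d") (auto simp: cD coeff_eq_0)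
  then have "degree D \<le> d" by (intro degree_le) auto
  moreover have "int p dvd poly D x" for x
    using Suc.prems(3) by (simp add: D_def poly_pcompose)
  ultimately have "int p dvd coeff D d"
    using Suc.IH Suc.prems(2) by simp
  moreover have "coeff D d = int (Suc d) * coeff q (Suc d)"
  proof -
    have "{d..Suc d} = {d, Suc d}" by auto
    then show ?thesis by (simp add: cD algebra_simps)
  qed
  ultimately have "int p dvd int (Suc d) * coeff q (Suc d)" by simp
  moreover have "\<not> int p dvd int (Suc d)"
    using Suc.prems(2) by (metis int_dvd_int_iff nat_dvd_not_less zero_less_Suc)
  ultimately show ?case
    using prime_dvd_mult_iff[of "int p"] \<open>prime p\<close> by (metis prime_nat_int_transfer)
qed

text \<open>Divisibility in \<open>int poly\<close> stands in for polynomials over the field with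
  \<open>p\<close> elements. A leading term divisible by \<open>p\<close> can be split off without
  disturbing the hypotheses, which allows induction on the degree.\<close>

lemma coeff_dvd_of_vanishing:
  fixes q :: "int poly"
  assumes "prime p" "degree q < p" "\<And>x. int p dvd poly q x"
  shows "int p dvd coeff q k"
  using assms(2-)
proof (induction "degree q" arbitrary: q rule: less_induct)
  case less
  let ?n = "degree q"
  have top: "int p dvd coeff q ?n"
    using top_coeff_dvd_of_vanishing[OF \<open>prime p\<close>, of q ?n] less.prems by simp
  show ?case
  proof (cases "?n = 0 \<or> k = ?n")
    case True
    then show ?thesis using top by (cases "k = ?n") (auto simp: coeff_eq_0)
  next
    case False
    define q' where "q' = q - monom (coeff q ?n) ?n"
    have "degree q' \<le> ?n" unfolding q'_def
      by (intro degree_diff_le degree_monom_le) auto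
    moreover have "coeff q' ?n = 0" by (simp add: q'_def)
    ultimately have deg: "degree q' < ?n"
      using False by (metis eq_zero_or_degree_less degree_0 bot_nat_0.not_eq_extremum)
    moreover have "int p dvd poly q' x" for x
      using less.prems(2) top by (simp add: q'_def poly_monom)
    ultimately have "int p dvd coeff q' k"
      using less.hyps[of q'] less.prems(1) by auto
    then show ?thesis using False by (simp add: q'_def)
  qed
qed

lemma fermat_theorem_int:
  assumes "prime p" "\<not> int p dvd a"
  shows "[a ^ (p - 1) = 1] (mod int p)"
proof -
  have p: "p > 0" using assms(1) prime_gt_0_nat by blast
  define b where "b = nat (a mod int p)"
  have b: "[int b = a] (mod int p)" using p by (simp add: b_def cong_def)
  then have "\<not> p dvd b"
    using assms(2) cong_dvd_iff int_dvd_int_iff by blast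
  then have "[int (b ^ (p - 1)) = int 1] (mod int p)"
    using fermat_theorem[OF assms(1)] cong_int_iff by blast
  then show ?thesis using b by (metis cong_pow cong_sym cong_trans of_nat_1 of_nat_power)
qed

lemma interpolation_mod_prime:
  fixes \<rho> :: "int \<Rightarrow> int"
  assumes "prime p" and per: "\<And>x y. [x = y] (mod int p) \<Longrightarrow> [\<rho> x = \<rho> y] (mod int p)"
  shows "\<exists>q :: int poly. degree q \<le> p - 1 \<and> (\<forall>x. [poly q x = \<rho> x] (mod int p))"
proof -
  have p: "p > 1" using assms(1) prime_gt_1_nat by blast
  \<comment> \<open>Lagrange interpolation: by Fermat, \<open>1 - (x - a) ^ (p - 1)\<close> is
    modulo \<open>p\<close> the indicator of the residue class of \<open>a\<close>.\<close>
  define q where "q = (\<Sum>a\<in>{0..<int p}. smult (\<rho> a) (1 - [:-a, 1:] ^ (p - 1)))"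
  have "degree ([:-a, 1:] ^ (p - 1)) \<le> p - 1" for a :: int
    using degree_power_le[of "[:-a, 1:]" "p - 1"] by simp
  then have "degree q \<le> p - 1" unfolding q_def
    by (intro degree_sum_le order_trans[OF degree_smult_le] degree_diff_le) auto
  moreover have "[poly q x = \<rho> x] (mod int p)" for x
  proof -
    have "poly q x = (\<Sum>a\<in>{0..<int p}. \<rho> a * (1 - (x - a) ^ (p - 1)))"
      by (simp add: q_def poly_sum)
    also have "[\<dots> = (\<Sum>a\<in>{0..<int p}. if a = x mod int p then \<rho> x else 0)] (mod int p)"
    proof (rule cong_sum)
      fix a assume a: "a \<in> {0..<int p}"
      show "[\<rho> a * (1 - (x - a) ^ (p - 1)) = (if a = x mod int p then \<rho> x else 0)] (mod int p)"
      proof (cases "a = x mod int p")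
        case True
        then have ax: "[a = x] (mod int p)" by (simp add: cong_def)
        then have "int p dvd x - a" by (simp add: cong_iff_dvd_diff dvd_diff_commute)
        then have "int p dvd (x - a) ^ (p - 1)" using p by (simp add: dvd_power_le dvd_trans dvd_power)
        then have "[1 - (x - a) ^ (p - 1) = 1] (mod int p)" by (simp add: cong_iff_dvd_diff)
        then have "[\<rho> a * (1 - (x - a) ^ (p - 1)) = \<rho> x * 1] (mod int p)"
          by (intro cong_mult per ax)
        then show ?thesis using True by simp
      next
        case False
        have "\<not> int p dvd x - a"
        proof
          assume "int p dvd x - a"
          then have "x mod int p = a mod int p" by (simp add: mod_eq_dvd_iff)
          then show False using False a by simp
        qed
        then have "[(x - a) ^ (p - 1) = 1] (mod int p)"
          by (rule fermat_theorem_int[OF assms(1)])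
        then have "int p dvd 1 - (x - a) ^ (p - 1)" by (simp add: cong_iff_dvd_diff dvd_diff_commute)
        then show ?thesis using False by (simp add: cong_iff_dvd_diff)
      qed
    qed
    also have "(\<Sum>a\<in>{0..<int p}. if a = x mod int p then \<rho> x else 0) = \<rho> x"
      using p by (simp add: sum.delta)
    finally show "[poly q x = \<rho> x] (mod int p)" .
  qed
  ultimately show ?thesis by blast
qed

text \<open>For a polynomial \<open>h\<close> of degree \<open>card U - 1\<close>, the sum of
  \<open>u * h u\<close> over \<open>U\<close> is a combination of the power sums with exponents
  from 1 to \<open>card U\<close>. Choosing \<open>h\<close> to vanish on all of \<open>U\<close>
  except \<open>v\<close> leaves one term, a product of units modulo \<open>p\<close>.\<close>

lemma exists_power_sum_not_dvd:
  fixes U :: "int set"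
  assumes "prime p" "U \<subseteq> {1..<int p}" "U \<noteq> {}"
  shows "\<exists>w. 0 < w \<and> w \<le> card U \<and> \<not> int p dvd (\<Sum>u\<in>U. u ^ w)"
proof (rule ccontr)
  assume "\<not> ?thesis"
  then have sdvd: "int p dvd (\<Sum>u\<in>U. u ^ w)" if "0 < w" "w \<le> card U" for w
    using that by blast
  have fin: "finite U" using assms(2) finite_subset by blast
  obtain v where v: "v \<in> U" using assms(3) by blast
  define h where "h = (\<Prod>u\<in>U - {v}. [:-u, 1:])"
  have "degree h = card (U - {v})"
    unfolding h_def by (subst degree_prod_sum_eq) (auto simp: fin)
  then have deg: "Suc (degree h) = card U"
    using v fin by (metis card_Suc_Diff1)
  have "(\<Sum>u\<in>U. u * poly h u) = (\<Sum>u\<in>U. \<Sum>i\<le>degree h. coeff h i * u ^ Suc i)"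
    by (simp add: poly_altdef sum_distrib_left mult_ac)
  also have "\<dots> = (\<Sum>i\<le>degree h. coeff h i * (\<Sum>u\<in>U. u ^ Suc i))"
    by (subst sum.swap) (simp add: sum_distrib_left)
  finally have "(\<Sum>u\<in>U. u * poly h u) = (\<Sum>i\<le>degree h. coeff h i * (\<Sum>u\<in>U. u ^ Suc i))" .
  moreover have "int p dvd (\<Sum>i\<le>degree h. coeff h i * (\<Sum>u\<in>U. u ^ Suc i))"
    using deg by (intro dvd_sum dvd_mult sdvd) auto
  moreover have "(\<Sum>u\<in>U. u * poly h u) = v * poly h v"
  proof -
    have "poly h u = 0" if "u \<in> U - {v}" for u
      using that fin by (auto simp: h_def poly_prod)
    then show ?thesis using sum.remove[OF fin v, of "\<lambda>u. u * poly h u"] by simp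
  qed
  ultimately have "int p dvd v * poly h v" by simp
  then have "int p dvd v * (\<Prod>u\<in>U - {v}. v - u)" by (simp add: h_def poly_prod)
  then have "int p dvd v \<or> (\<exists>u\<in>U - {v}. int p dvd v - u)"
    using assms(1) fin by (simp add: prime_dvd_mult_iff prime_dvd_prod_iff)
  moreover have "\<not> int p dvd v"
    using assms(2) v by (auto dest!: zdvd_imp_le)
  moreover have "\<not> int p dvd v - u" if "u \<in> U - {v}" for u
  proof
    assume "int p dvd v - u"
    then have "v mod int p = u mod int p" by (simp add: mod_eq_dvd_iff)
    moreover have "0 \<le> v" "v < int p" "0 \<le> u" "u < int p" using that v assms(2) by auto
    ultimately show False using that by simp
  qed
  ultimately show False by blast
qed

text \<open>P. Mueller's proof of Burnside's theorem on permutation groups of prime degree: represent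
  \<open>\<rho>\<close> by a polynomial \<open>q\<close> of minimal degree \<open>n\<close> over the field with \<open>p\<close> elements, and compare
  coefficients in \<open>\<Sum>u\<in>U. q (x + u) ^ m = \<Sum>u\<in>U. (q x + u) ^ m\<close>.\<close>

lemma affine_of_difference_preserving:
  fixes \<rho> :: "int \<Rightarrow> int" and U :: "int set"
  assumes "prime p"
    and per: "\<And>x y. [x = y] (mod int p) \<Longrightarrow> [\<rho> x = \<rho> y] (mod int p)"
    and inj: "\<And>x y. [\<rho> x = \<rho> y] (mod int p) \<Longrightarrow> [x = y] (mod int p)"
    and U: "U \<subseteq> {1..<int p}" "U \<noteq> {}" "2 * card U < p"
    and pres: "\<And>x y. (y - x) mod int p \<in> U \<Longrightarrow> (\<rho> y - \<rho> x) mod int p \<in> U"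
  shows "\<exists>c d. \<forall>x. [\<rho> x = c * x + d] (mod int p)"
proof -
  have p: "p > 1" using assms(1) prime_gt_1_nat by blast
  have fin: "finite U" using U(1) finite_subset by blast
  define good where "good q \<longleftrightarrow> (\<forall>x. [poly q x = \<rho> x] (mod int p))" for q
  obtain q0 where q0: "degree q0 \<le> p - 1" "good q0"
    using interpolation_mod_prime[of p \<rho>] assms(1) per unfolding good_def by blast
  have "\<exists>q. degree q = (LEAST n. \<exists>q. degree q = n \<and> good q) \<and> good q"
    by (rule LeastI[of "\<lambda>n. \<exists>q. degree q = n \<and> good q" "degree q0"]) (use q0 in blast)
  then obtain q n where q: "degree q = n" "good q"
    and n: "n = (LEAST n. \<exists>q. degree q = n \<and> good q)"
    by blast
  have n_min: "n \<le> degree q'" if "good q'" for q'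
    unfolding n by (rule Least_le) (use that in blast)
  then have n_less: "n < p" using q0 p by fastforce
  have "n \<le> 1"
  proof (rule ccontr)
    assume "\<not> n \<le> 1"
    then have n2: "n \<ge> 2" by simp
    define lc where "lc = coeff q n"
    \<comment> \<open>Otherwise dropping the leading monomial would represent \<open>\<rho>\<close>
      in degree below \<open>n\<close>.\<close>
    have lc: "\<not> int p dvd lc"
    proof
      assume dvd: "int p dvd lc"
      define q' where "q' = q - monom lc n"
      have "good q'" unfolding good_def
      proof
        fix x
        have "[poly q x - lc * x ^ n = \<rho> x - 0] (mod int p)"
          using q(2) dvd unfolding good_def by (intro cong_diff) (auto simp: cong_0_iff)
        then show "[poly q' x = \<rho> x] (mod int p)" by (simp add: q'_def poly_monom)
      qed
      moreover have "degree q' < n"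
      proof -
        have "degree q' \<le> n" unfolding q'_def using q(1)
          by (intro degree_diff_le degree_monom_le) auto
        moreover have "coeff q' n = 0" by (simp add: q'_def lc_def)
        ultimately show ?thesis
          using n2 by (metis eq_zero_or_degree_less degree_0 bot_nat_0.not_eq_extremum not_numeral_le_zero)
      qed
      ultimately show False using n_min leD by blast
    qed
    define s where "s k = (\<Sum>u\<in>U. u ^ k)" for k
    \<comment> \<open>The first power sum of positive exponent that survives modulo
      \<open>p\<close>. Since \<open>w \<le> card U\<close>, the bound on \<open>U\<close> gives
      \<open>2 * w < p\<close>.\<close>
    define w where "w = (LEAST w. 0 < w \<and> \<not> int p dvd s w)"
    obtain w' where w': "0 < w'" "w' \<le> card U" "\<not> int p dvd s w'"
      using exists_power_sum_not_dvd[OF assms(1) U(1,2)] unfolding s_def by blast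
    have w: "0 < w" "\<not> int p dvd s w"
      using LeastI[of "\<lambda>w. 0 < w \<and> \<not> int p dvd s w" w'] w' unfolding w_def by auto
    have "w \<le> w'" unfolding w_def using w' by (intro Least_le[of "\<lambda>w. 0 < w \<and> \<not> int p dvd s w"]) auto
    then have wU: "2 * w < p" using w'(2) U(3) by linarith
    have s_dvd: "int p dvd s k" if "0 < k" "k < w" for k
      using not_less_Least[of k "\<lambda>w. 0 < w \<and> \<not> int p dvd s w"] that unfolding w_def by auto
    \<comment> \<open>The largest exponent for which the degree \<open>N\<close> of
      \<open>q ^ m\<close> stays below \<open>p\<close>, so that values modulo \<open>p\<close>
      determine coefficients modulo \<open>p\<close>.\<close>
    define m where "m = (p - 1) div n"
    define N where "N = m * n"
    have Np: "N < p" using p unfolding N_def m_def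
      by (metis diff_less div_times_less_eq_dividend le_less_trans less_trans zero_less_one)
    \<comment> \<open>The remainder of \<open>p - 1\<close> by \<open>n\<close> is less than
      \<open>n \<le> N\<close>, so \<open>N\<close> exceeds half of \<open>p - 1\<close>.\<close>
    have wN: "w \<le> N"
    proof -
      have "p - 1 = N + (p - 1) mod n" by (simp add: N_def m_def)
      moreover have "(p - 1) mod n < n" using n2 by simp
      moreover have "n \<le> N"
        using div_le_mono[of n "p - 1" n] n_less n2 unfolding N_def m_def by simp
      ultimately show ?thesis using wU by linarith
    qed
    define Q where "Q = q ^ m"
    have degQ: "degree Q \<le> N" unfolding Q_def N_def using degree_power_le[of q m] q(1)
      by (simp add: mult.commute)
    have "q \<noteq> 0" using n2 q(1) by auto
    then have coeffQ: "coeff Q N = lc ^ m"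
      unfolding Q_def N_def lc_def q(1)[symmetric]
      by (simp flip: degree_power_eq lead_coeff_power)
    define D1 where "D1 = (\<Sum>u\<in>U. pcompose Q [:u, 1:])"
    define D2 where "D2 = (\<Sum>u\<in>U. (q + [:u:]) ^ m)"
    \<comment> \<open>For fixed \<open>x\<close>, the reduced difference of
      \<open>\<rho> (x + u)\<close> and \<open>\<rho> x\<close> permutes \<open>U\<close> as
      \<open>u\<close> varies, so both sides sum the same powers.\<close>
    have "int p dvd poly (D1 - D2) x" for x
    proof -
      have "[poly D1 x = (\<Sum>u\<in>U. \<rho> (x + u) ^ m)] (mod int p)"
        unfolding D1_def Q_def poly_sum poly_pcompose poly_power
        using q(2) by (intro cong_sum cong_pow) (auto simp: good_def add.commute)
      also have "[(\<Sum>u\<in>U. \<rho> (x + u) ^ m) = (\<Sum>u\<in>U. (\<rho> x + (\<rho> (x + u) - \<rho> x) mod int p) ^ m)] (mod int p)"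
        by (intro cong_sum cong_pow) (simp add: cong_def mod_simps)
      also have "(\<Sum>u\<in>U. (\<rho> x + (\<rho> (x + u) - \<rho> x) mod int p) ^ m) = (\<Sum>v\<in>U. (\<rho> x + v) ^ m)"
      proof (rule sum.reindex_bij_betw)
        have "(\<lambda>u. (\<rho> (x + u) - \<rho> x) mod int p) ` U \<subseteq> U"
        proof safe
          fix u assume "u \<in> U"
          then have "(x + u - x) mod int p \<in> U" using U(1) by auto
          then show "(\<rho> (x + u) - \<rho> x) mod int p \<in> U" by (rule pres)
        qed
        moreover have "inj_on (\<lambda>u. (\<rho> (x + u) - \<rho> x) mod int p) U"
        proof (rule inj_onI)
          fix u v assume uv: "u \<in> U" "v \<in> U"
            and "(\<rho> (x + u) - \<rho> x) mod int p = (\<rho> (x + v) - \<rho> x) mod int p"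
          then have "[\<rho> (x + u) = \<rho> (x + v)] (mod int p)"
            by (simp add: mod_eq_dvd_iff cong_iff_dvd_diff)
          then have "[x + u = x + v] (mod int p)" by (rule inj)
          then have "u mod int p = v mod int p"
            by (simp add: mod_eq_dvd_iff cong_iff_dvd_diff)
          moreover have "0 \<le> v" "v < int p" "0 \<le> u" "u < int p" using uv U(1) by auto
          ultimately show "u = v" by simp
        qed
        ultimately show "bij_betw (\<lambda>u. (\<rho> (x + u) - \<rho> x) mod int p) U U"
          using fin by (metis bij_betw_def card_image card_subset_eq)
      qed
      also have "[(\<Sum>v\<in>U. (\<rho> x + v) ^ m) = poly D2 x] (mod int p)"
        unfolding D2_def poly_sum poly_power poly_add
        using q(2) by (intro cong_sum cong_pow cong_add) (auto simp: good_def cong_sym)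
      finally show ?thesis by (simp add: cong_iff_dvd_diff)
    qed
    moreover have "degree (D1 - D2) \<le> N"
    proof (rule degree_diff_le)
      show "degree D1 \<le> N" unfolding D1_def
      proof (intro degree_sum_le fin)
        fix u
        show "degree (pcompose Q [:u, 1:]) \<le> N"
          using degree_pcompose_le[of Q "[:u, 1:]"] degQ by simp
      qed
      show "degree D2 \<le> N" unfolding D2_def
      proof (intro degree_sum_le fin)
        fix u :: int
        have "degree (q + [:u:]) \<le> n" using q(1) by (intro degree_add_le) auto
        then have "degree (q + [:u:]) * m \<le> n * m" by simp
        then show "degree ((q + [:u:]) ^ m) \<le> N"
          using degree_power_le[of "q + [:u:]" m] unfolding N_def
          by (metis order_trans mult.commute)
      qed
    qed
    \<comment> \<open>\<open>N - w\<close> is the highest position at which \<open>s w\<close>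
      occurs in \<open>D1\<close>, and there it is multiplied by the leading coefficient of
      \<open>Q\<close>. In \<open>D2\<close> only the term without power of \<open>u\<close>
      survives modulo \<open>p\<close>.\<close>
    ultimately have dvdD: "int p dvd coeff D1 (N - w) - coeff D2 (N - w)"
      using coeff_dvd_of_vanishing[OF assms(1), of "D1 - D2" "N - w"] Np by simp
    have "coeff D1 (N - w) = (\<Sum>i=N-w..N. coeff Q i * (int (i choose (N - w)) * s (i - (N - w))))"
      unfolding D1_def coeff_sum coeff_pcompose_shift[OF degQ] s_def
      by (subst sum.swap) (simp add: sum_distrib_left)
    also have "\<dots> = coeff Q (N - w) * (int ((N - w) choose (N - w)) * s 0)
        + (\<Sum>i\<in>{N-w<..<N}. coeff Q i * (int (i choose (N - w)) * s (i - (N - w))))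
        + coeff Q N * (int (N choose (N - w)) * s w)"
    proof -
      have "{N-w..N} = insert (N - w) (insert N {N-w<..<N})" using w(1) wN by auto
      then show ?thesis using w(1) wN by simp
    qed
    also have "\<dots> = int (card U) * coeff Q (N - w)
        + (\<Sum>i\<in>{N-w<..<N}. coeff Q i * (int (i choose (N - w)) * s (i - (N - w))))
        + lc ^ m * (int (N choose w) * s w)"
      using binomial_symmetric[OF wN] by (simp add: coeffQ s_def)
    finally have eq1: "coeff D1 (N - w) = int (card U) * coeff Q (N - w)
        + (\<Sum>i\<in>{N-w<..<N}. coeff Q i * (int (i choose (N - w)) * s (i - (N - w))))
        + lc ^ m * (int (N choose w) * s w)" .
    have dvd1: "int p dvd (\<Sum>i\<in>{N-w<..<N}. coeff Q i * (int (i choose (N - w)) * s (i - (N - w))))"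
      by (intro dvd_sum dvd_mult s_dvd) auto
    have dvd2: "int p dvd coeff D2 (N - w) - int (card U) * coeff Q (N - w)"
    proof -
      have "D2 = (\<Sum>u\<in>U. \<Sum>k\<le>m. of_nat (m choose k) * [:u:] ^ k * q ^ (m - k))"
        unfolding D2_def by (subst add.commute) (simp add: binomial_ring)
      also have "\<dots> = (\<Sum>k\<le>m. \<Sum>u\<in>U. smult (int (m choose k) * u ^ k) (q ^ (m - k)))"
        by (subst sum.swap) (simp add: of_nat_poly poly_const_pow mult.commute)
      finally have "coeff D2 (N - w) = (\<Sum>k\<le>m. int (m choose k) * s k * coeff (q ^ (m - k)) (N - w))"
        by (simp add: coeff_sum s_def sum_distrib_left sum_distrib_right)
      also have "\<dots> = s 0 * coeff Q (N - w)
          + (\<Sum>k\<in>{0<..m}. int (m choose k) * s k * coeff (q ^ (m - k)) (N - w))"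
      proof -
        have "{..m} = insert 0 {0<..m}" by auto
        then show ?thesis by (simp add: Q_def)
      qed
      finally have eq: "coeff D2 (N - w) = s 0 * coeff Q (N - w)
          + (\<Sum>k\<in>{0<..m}. int (m choose k) * s k * coeff (q ^ (m - k)) (N - w))" .
      have "int p dvd (\<Sum>k\<in>{0<..m}. int (m choose k) * s k * coeff (q ^ (m - k)) (N - w))"
      proof (rule dvd_sum)
        fix k assume k: "k \<in> {0<..m}"
        show "int p dvd int (m choose k) * s k * coeff (q ^ (m - k)) (N - w)"
        proof (cases "k < w")
          case True
          then show ?thesis using s_dvd k by simp
        next
          case False
          have "degree (q ^ (m - k)) \<le> n * (m - k)" using degree_power_le[of q "m - k"] q(1) by simp
          also have "\<dots> = N - n * k" by (simp add: N_def right_diff_distrib' mult.commute)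
          \<comment> \<open>Nonlinearity enters here: \<open>n \<ge> 2\<close> gives
            \<open>n * k \<ge> 2 * k > w\<close>, so the degree is too small to reach the
            coefficient at \<open>N - w\<close>.\<close>
          also have "\<dots> < N - w"
          proof -
            have "2 * k \<le> n * k" using n2 by simp
            then have "w < n * k" using False w(1) by linarith
            moreover have "n * k \<le> N" using k by (simp add: N_def mult.commute)
            ultimately show ?thesis by linarith
          qed
          finally show ?thesis by (simp add: coeff_eq_0)
        qed
      qed
      then show ?thesis unfolding eq by (simp add: s_def)
    qed
    have "int p dvd lc ^ m * (int (N choose w) * s w)"
      using dvd_diff[OF dvd_add[OF dvdD dvd2] dvd1] by (simp add: eq1)
    moreover have "prime (int p)" using assms(1) by simp
    \<comment> \<open>Only the binomial coefficient can absorb \<open>p\<close>, but it divides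
      \<open>fact N\<close> and \<open>N < p\<close>.\<close>
    ultimately have "int p dvd int (N choose w)"
      using lc w(2) by (metis prime_dvd_mult_iff prime_dvd_power)
    then have "p dvd N choose w" by simp
    then have "p dvd fact N"
      using wN by (metis binomial_fact_lemma dvd_mult)
    then show False using assms(1) Np by (simp add: prime_dvd_fact_iff)
  qed
  then have "poly q x = coeff q 1 * x + coeff q 0" for x
    using q(1) by (cases n) (auto simp: poly_altdef coeff_eq_0)
  then show ?thesis using q(2) unfolding good_def by (metis cong_sym)
qed

section \<open>S-rings given by colourings\<close>

text \<open>Basic sets are encoded as level sets of a colouring, so that lying in their span becomes
  constancy on equal colours.\<close>

definition colour_classes :: "('a, 'b) monoid_scheme \<Rightarrow> ('a \<Rightarrow> 'c) \<Rightarrow> 'a set set" where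
  "colour_classes G col = (\<lambda>x. {y \<in> carrier G. col y = col x}) ` carrier G"

lemma partition_on_colour_classes: "partition_on (carrier G) (colour_classes G col)"
  by (rule partition_onI) (auto simp: colour_classes_def disjnt_def)

lemma int_span_constant:
  assumes "h \<in> int_span B" "\<And>b. b \<in> B \<Longrightarrow> b x = b y"
  shows "h x = h y"
proof -
  obtain T c where h: "h = (\<lambda>x. \<Sum>b\<in>T. c b * b x)" and T: "T \<subseteq> B"
    using assms(1) unfolding int_span_def by blast
  then show ?thesis using assms(2) by (auto intro!: sum.cong)
qed

lemma int_span_superset:
  assumes "b \<in> B"
  shows "b \<in> int_span B"
  unfolding int_span_def
proof (rule CollectI, intro exI conjI)
  show "b = (\<lambda>x. \<Sum>b\<in>{b}. (\<lambda>_. 1) b * b x)" by simp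
qed (use assms in simp_all)

text \<open>The classes are disjoint, so the coefficient of a class is the value of \<open>h\<close>
  on it. The description replaces spans by conditions on functions.\<close>

lemma int_span_colour_classes:
  assumes fin: "finite (carrier G)"
  shows "int_span (indicator ` colour_classes G col) =
    {h. (\<forall>x. x \<notin> carrier G \<longrightarrow> h x = 0) \<and>
        (\<forall>x\<in>carrier G. \<forall>y\<in>carrier G. col x = col y \<longrightarrow> h x = h y)}" (is "?A = ?B")
proof (intro equalityI subsetI)
  fix h assume h: "h \<in> ?A"
  then obtain T c where hT: "h = (\<lambda>x. \<Sum>b\<in>T. c b * b x)"
    and T: "T \<subseteq> indicator ` colour_classes G col"
    unfolding int_span_def by blast
  have "h x = 0" if "x \<notin> carrier G" for x
    unfolding hT
  proof (intro sum.neutral ballI)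
    fix b assume "b \<in> T"
    then have "b x = 0" using T that by (auto simp: colour_classes_def)
    then show "c b * b x = 0" by simp
  qed
  moreover have "h x = h y" if "x \<in> carrier G" "y \<in> carrier G" "col x = col y" for x y
    using that by (intro int_span_constant[OF h]) (auto simp: colour_classes_def indicator_def)
  ultimately show "h \<in> ?B" by blast
next
  fix h assume h: "h \<in> ?B"
  then have hc: "h x = h y" if "x \<in> carrier G" "y \<in> carrier G" "col x = col y" for x y
    using that by blast
  define S where "S = colour_classes G col"
  have S: "finite S" unfolding S_def colour_classes_def using fin by simp
  \<comment> \<open>\<open>int_span\<close> indexes coefficients by functions, not by sets; a point
    of the class is recovered from its indicator by choice.\<close>
  define c where "c b = h (SOME x. x \<in> carrier G \<and> b x = 1)" for b :: "'a \<Rightarrow> int"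
  have inj: "inj_on (indicator :: 'a set \<Rightarrow> 'a \<Rightarrow> int) S"
    by (rule inj_onI) (metis (no_types) indicator_eq_1_iff subsetI subset_antisym)
  have c: "c (indicator X) = h x" if XS: "X \<in> S" and xX: "x \<in> X" for X x
  proof -
    let ?y = "SOME x. x \<in> carrier G \<and> (indicator X :: 'a \<Rightarrow> int) x = 1"
    obtain z where X: "X = {y \<in> carrier G. col y = col z}"
      using XS unfolding S_def colour_classes_def by blast
    then have "x \<in> carrier G \<and> (indicator X :: 'a \<Rightarrow> int) x = 1" using xX by auto
    then have "?y \<in> carrier G \<and> (indicator X :: 'a \<Rightarrow> int) ?y = 1" by (rule someI)
    then have "?y \<in> X" by (simp add: indicator_eq_1_iff)
    then have "h ?y = h x" using xX unfolding X by (intro hc) simp_all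
    then show ?thesis by (simp add: c_def)
  qed
  have "h x = (\<Sum>b\<in>indicator ` S. c b * b x)" for x
  proof -
    have "(\<Sum>b\<in>indicator ` S. c b * b x) = (\<Sum>X\<in>S. c (indicator X) * indicator X x)"
      using inj by (simp add: sum.reindex)
    also have "\<dots> = (\<Sum>X\<in>S. if X = {y \<in> carrier G. col y = col x} \<and> x \<in> carrier G then h x else 0)"
    proof (rule sum.cong[OF refl])
      fix X assume X: "X \<in> S"
      then have "x \<in> X \<longleftrightarrow> X = {y \<in> carrier G. col y = col x} \<and> x \<in> carrier G"
        by (auto simp: S_def colour_classes_def)
      then show "c (indicator X) * indicator X x
          = (if X = {y \<in> carrier G. col y = col x} \<and> x \<in> carrier G then h x else 0)"
        using c[OF X] by (auto simp: indicator_def)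
    qed
    also have "\<dots> = h x"
    proof (cases "x \<in> carrier G")
      case True
      then have "{y \<in> carrier G. col y = col x} \<in> S" by (auto simp: S_def colour_classes_def)
      then show ?thesis using True S by (simp add: sum.delta)
    next
      case False
      then show ?thesis using h by simp
    qed
    finally show ?thesis ..
  qed
  then have "h = (\<lambda>x. \<Sum>b\<in>indicator ` S. c b * b x)" by (rule ext)
  then show "h \<in> ?A" unfolding int_span_def S_def[symmetric] using S by blast
qed

text \<open>Multiplicative closure is demanded for arbitrary colour-constant functions rather than
  for pairs of classes, which leaves the application free to decompose such functions
  conveniently.\<close>

lemma s_ring_of_colouring:
  fixes G (structure)
  assumes "group G" and fin: "finite (carrier G)"
    and one: "\<And>x. x \<in> carrier G \<Longrightarrow> col x = col \<one> \<Longrightarrow> x = \<one>"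
    and inv: "\<And>x y. x \<in> carrier G \<Longrightarrow> y \<in> carrier G \<Longrightarrow> col x = col y \<Longrightarrow> col (inv x) = col (inv y)"
    and mult: "\<And>h h' x y. \<lbrakk>\<And>x y. x \<in> carrier G \<Longrightarrow> y \<in> carrier G \<Longrightarrow> col x = col y \<Longrightarrow> h x = h y;
        \<And>x y. x \<in> carrier G \<Longrightarrow> y \<in> carrier G \<Longrightarrow> col x = col y \<Longrightarrow> h' x = h' y;
        x \<in> carrier G; y \<in> carrier G; col x = col y\<rbrakk>
      \<Longrightarrow> (\<Sum>z\<in>carrier G. h z * h' (inv z \<otimes> x)) = (\<Sum>z\<in>carrier G. h z * (h' (inv z \<otimes> y) :: int))"
  shows "s_ring G (int_span (indicator ` colour_classes G col))"
proof -
  interpret group G by fact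
  interpret R: ring "group_ring G" by (rule ring_group_ring) fact+
  define A where "A = int_span (indicator ` colour_classes G col)"
  have A: "A = {h. (\<forall>x. x \<notin> carrier G \<longrightarrow> h x = 0) \<and>
        (\<forall>x\<in>carrier G. \<forall>y\<in>carrier G. col x = col y \<longrightarrow> h x = h y)}"
    unfolding A_def by (rule int_span_colour_classes[OF fin])
  have A0: "h x = 0" if "h \<in> A" "x \<notin> carrier G" for h x
    using that unfolding A by blast
  have Ac: "h x = h y" if "h \<in> A" "x \<in> carrier G" "y \<in> carrier G" "col x = col y" for h x y
    using that unfolding A by blast
  have AI: "h \<in> A" if "\<And>x. x \<notin> carrier G \<Longrightarrow> h x = 0"
    "\<And>x y. x \<in> carrier G \<Longrightarrow> y \<in> carrier G \<Longrightarrow> col x = col y \<Longrightarrow> h x = h y" for h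
    using that unfolding A by blast
  have "subring A (group_ring G)"
  proof (rule R.subringI)
    show sub: "A \<subseteq> carrier (group_ring G)" by (auto simp: A0 group_ring_def)
    show "\<one>\<^bsub>group_ring G\<^esub> \<in> A"
    proof (rule AI)
      fix x y assume "x \<in> carrier G" "y \<in> carrier G" "col x = col y"
      then have "x = \<one> \<longleftrightarrow> y = \<one>" using one by metis
      then show "\<one>\<^bsub>group_ring G\<^esub> x = \<one>\<^bsub>group_ring G\<^esub> y"
        by (simp add: group_ring_def indicator_def)
    qed (auto simp: group_ring_def indicator_def)
    fix h assume h: "h \<in> A"
    have neg: "(\<lambda>x. - h x) \<oplus>\<^bsub>group_ring G\<^esub> h = \<zero>\<^bsub>group_ring G\<^esub>"
      "(\<lambda>x. - h x) \<in> carrier (group_ring G)"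
      using h by (simp_all add: A0 group_ring_def)
    have "\<ominus>\<^bsub>group_ring G\<^esub> h = (\<lambda>x. - h x)"
      by (rule R.minus_equality[OF neg(1) subsetD[OF sub h] neg(2)])
    then show "\<ominus>\<^bsub>group_ring G\<^esub> h \<in> A"
      using A0[OF h] Ac[OF h] by (metis (no_types, lifting) AI neg_equal_0_iff_equal)
  next
    fix h h' assume hh: "h \<in> A" "h' \<in> A"
    show "h \<oplus>\<^bsub>group_ring G\<^esub> h' \<in> A"
    proof (rule AI)
      fix x y assume xy: "x \<in> carrier G" "y \<in> carrier G" "col x = col y"
      show "(h \<oplus>\<^bsub>group_ring G\<^esub> h') x = (h \<oplus>\<^bsub>group_ring G\<^esub> h') y"
        using Ac[OF hh(1) xy] Ac[OF hh(2) xy] by (simp add: group_ring_def)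
    qed (simp add: group_ring_def A0 hh)
    show "h \<otimes>\<^bsub>group_ring G\<^esub> h' \<in> A"
    proof (rule AI)
      fix x y assume xy: "x \<in> carrier G" "y \<in> carrier G" "col x = col y"
      show "(h \<otimes>\<^bsub>group_ring G\<^esub> h') x = (h \<otimes>\<^bsub>group_ring G\<^esub> h') y"
        using mult[OF Ac[OF hh(1)] Ac[OF hh(2)] xy] xy(1,2) by (simp add: group_ring_def)
    qed (simp add: group_ring_def)
  qed
  moreover have "{\<one>} \<in> colour_classes G col"
    using one by (auto simp: colour_classes_def intro!: image_eqI[of _ _ \<one>])
  moreover have "m_inv G ` X \<in> colour_classes G col" if X: "X \<in> colour_classes G col" for X
  proof -
    obtain x where x: "x \<in> carrier G" "X = {y \<in> carrier G. col y = col x}"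
      using X by (auto simp: colour_classes_def)
    have "m_inv G ` X = {y \<in> carrier G. col y = col (inv x)}"
    proof (intro equalityI subsetI)
      fix y assume y: "y \<in> {y \<in> carrier G. col y = col (inv x)}"
      then have "inv y \<in> X" using x inv[of y "inv x"] by auto
      then show "y \<in> m_inv G ` X" using y by (intro image_eqI[of _ _ "inv y"]) auto
    next
      fix y assume "y \<in> m_inv G ` X"
      then obtain z where "z \<in> carrier G" "col z = col x" "y = inv z" using x(2) by blast
      then show "y \<in> {y \<in> carrier G. col y = col (inv x)}" using inv[of z x] x(1) by simp
    qed
    then show ?thesis using x(1) by (auto simp: colour_classes_def)
  qed
  ultimately show ?thesis
    unfolding s_ring_def A_def using partition_on_colour_classes[of G col] by blast
qed

text \<open>Equal colours put \<open>a\<close> and \<open>b\<close> into one orbit of the stabilizer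
  of the identity. Composition with right translations then turns the colour invariance of
  stabilizer elements into invariance of all quotients.\<close>

lemma schurian_colouring_permutation:
  fixes G (structure)
  assumes "group G" and fin: "finite (carrier G)"
    and sch: "schurian G (int_span (indicator ` colour_classes G col))"
    and ab: "a \<in> carrier G" "b \<in> carrier G" "col a = col b"
  obtains \<kappa> where "bij_betw \<kappa> (carrier G) (carrier G)" "\<kappa> \<one> = \<one>" "\<kappa> a = b"
    "\<And>x y. x \<in> carrier G \<Longrightarrow> y \<in> carrier G \<Longrightarrow> col (\<kappa> y \<otimes> inv (\<kappa> x)) = col (y \<otimes> inv x)"
proof -
  interpret group G by fact
  let ?S = "carrier G"
  define A where "A = int_span (indicator ` colour_classes G col)"
  have A: "A = {h. (\<forall>x. x \<notin> carrier G \<longrightarrow> h x = 0) \<and>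
        (\<forall>x\<in>carrier G. \<forall>y\<in>carrier G. col x = col y \<longrightarrow> h x = h y)}"
    unfolding A_def by (rule int_span_colour_classes[OF fin])
  have Ac: "h x = h y" if "h \<in> A" "x \<in> carrier G" "y \<in> carrier G" "col x = col y" for h x y
    using that unfolding A by blast
  obtain K where K: "subgroup K (BijGroup ?S)" "right_translations G \<subseteq> K"
    and AK: "A = transitivity_module K G"
    using sch unfolding schurian_def A_def by blast
  have KB: "K \<subseteq> Bij ?S" using subgroup.subset[OF K(1)] by (simp add: BijGroup_def)
  have comp: "compose ?S g f \<in> K" if "g \<in> K" "f \<in> K" for f g
    using subgroup.m_closed[OF K(1) that] KB that by (auto simp: BijGroup_def subset_iff)
  have invK: "restrict (inv_into ?S f) ?S \<in> K" if "f \<in> K" for f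
    using subgroup.m_inv_closed[OF K(1) that] inv_BijGroup[of f ?S] KB that by auto
  have bij: "bij_betw f ?S ?S" if "f \<in> K" for f
    using that KB by (auto simp: Bij_def)
  have closed: "f x \<in> ?S" if "f \<in> K" "x \<in> ?S" for f x
    using bij[OF that(1)] that(2) by (auto dest: bij_betwE)
  define Ke where "Ke = {f \<in> K. f \<one> = \<one>}"
  define Orb where "Orb x = {f x | f. f \<in> Ke}" for x
  have AO: "A = int_span (indicator ` {Orb x | x. x \<in> ?S})"
    by (simp add: AK transitivity_module_def orbits_def orbit_def stabilizer_def Ke_def Orb_def)
  have Ke_comp: "compose ?S g f \<in> Ke" if "g \<in> Ke" "f \<in> Ke" for f g
    using that comp by (auto simp: Ke_def compose_def)
  have Ke_inv: "restrict (inv_into ?S f) ?S \<in> Ke" if "f \<in> Ke" for f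
    using that invK bij by (auto simp: Ke_def) (metis bij_betw_inv_into_left one_closed)
  have id: "(\<lambda>x\<in>?S. x) \<in> Ke"
    using subgroup.one_closed[OF K(1)] by (simp add: Ke_def BijGroup_def)
  have OrbE: "f z \<in> Orb w \<longleftrightarrow> z \<in> Orb w" if f: "f \<in> Ke" and z: "z \<in> ?S" and w: "w \<in> ?S" for f z w
  proof
    assume "z \<in> Orb w"
    then obtain g where g: "g \<in> Ke" "z = g w" by (auto simp: Orb_def)
    then have "f z = compose ?S f g w" using w by (simp add: compose_def)
    then show "f z \<in> Orb w" using Ke_comp[OF f g(1)] by (auto simp: Orb_def)
  next
    assume "f z \<in> Orb w"
    then obtain g where g: "g \<in> Ke" "f z = g w" by (auto simp: Orb_def)
    have fK: "f \<in> K" "g \<in> K" using f g by (auto simp: Ke_def)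
    have "z = inv_into ?S f (f z)" using bij_betw_inv_into_left[OF bij[OF fK(1)] z] by simp
    also have "\<dots> = compose ?S (restrict (inv_into ?S f) ?S) g w"
      using g(2) w closed[OF fK(2) w] by (simp add: compose_def)
    finally show "z \<in> Orb w" using Ke_comp[OF Ke_inv[OF f] g(1)] by (auto simp: Orb_def)
  qed
  \<comment> \<open>The indicator of a colour class lies in the span of the orbit indicators, hence
    is constant along orbits.\<close>
  have col_inv: "col (f x) = col x" if f: "f \<in> Ke" and x: "x \<in> ?S" for f x
  proof -
    let ?h = "indicator {y \<in> ?S. col y = col x} :: 'a \<Rightarrow> int"
    have "?h \<in> A" by (auto simp: A indicator_def)
    then have "?h (f x) = ?h x" unfolding AO
    proof (rule int_span_constant)
      fix b :: "'a \<Rightarrow> int" assume "b \<in> indicator ` {Orb x | x. x \<in> ?S}"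
      then show "b (f x) = b x" using OrbE[OF f x] by (auto simp: indicator_def)
    qed
    then show ?thesis using x by (auto simp: indicator_def split: if_splits)
  qed
  \<comment> \<open>Conversely, the indicator of an orbit is constant on colours and cannot separate
    \<open>a\<close> from \<open>b\<close>.\<close>
  have "indicator (Orb a) \<in> A" unfolding AO using ab(1) by (intro int_span_superset) blast
  then have "indicator (Orb a) b = (indicator (Orb a) a :: int)"
    using Ac[OF _ ab] by metis
  moreover have "a \<in> Orb a" using id ab by (auto simp: Orb_def intro!: exI[of _ "\<lambda>x\<in>?S. x"])
  ultimately have "b \<in> Orb a" by (auto simp: indicator_def split: if_splits)
  then obtain \<kappa> where \<kappa>: "\<kappa> \<in> Ke" "\<kappa> a = b" by (auto simp: Orb_def)
  have \<kappa>K: "\<kappa> \<in> K" using \<kappa> by (simp add: Ke_def)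
  show thesis
  proof
    show "bij_betw \<kappa> ?S ?S" by (rule bij[OF \<kappa>K])
    show "\<kappa> \<one> = \<one>" using \<kappa> by (simp add: Ke_def)
    show "\<kappa> a = b" by fact
    fix x y assume xy: "x \<in> ?S" "y \<in> ?S"
    have \<kappa>xy: "\<kappa> x \<in> ?S" "\<kappa> y \<in> ?S" using closed[OF \<kappa>K] xy by auto
    define R where "R g = (\<lambda>x\<in>?S. x \<otimes> g)" for g
    have RK: "R g \<in> K" if "g \<in> ?S" for g using K(2) that by (auto simp: right_translations_def R_def)
    \<comment> \<open>Translating by \<open>x\<close> before and by the inverse of
      \<open>\<kappa> x\<close> after brings \<open>\<kappa>\<close> into the stabilizer of the
      identity.\<close>
    define \<tau> where "\<tau> = compose ?S (R (inv (\<kappa> x))) (compose ?S \<kappa> (R x))"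
    have \<tau>: "\<tau> z = \<kappa> (z \<otimes> x) \<otimes> inv (\<kappa> x)" if "z \<in> ?S" for z
      using that xy closed[OF \<kappa>K] by (simp add: \<tau>_def compose_def R_def)
    have "\<tau> \<in> K" unfolding \<tau>_def using xy \<kappa>xy by (intro comp RK \<kappa>K) auto
    moreover have "\<tau> \<one> = \<one>" using xy \<kappa>xy by (simp add: \<tau>)
    ultimately have "\<tau> \<in> Ke" by (simp add: Ke_def)
    then have "col (\<tau> (y \<otimes> inv x)) = col (y \<otimes> inv x)" using xy by (intro col_inv) auto
    then show "col (\<kappa> y \<otimes> inv (\<kappa> x)) = col (y \<otimes> inv x)" using xy by (simp add: \<tau> m_assoc)
  qed
qed

section \<open>Sign patterns on the nonzero residues\<close>

text \<open>\<open>f_shift\<close> makes sums of \<open>f\<close> cancel, \<open>f_minus\<close>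
  lets inversion respect the colouring, and \<open>f_distinct\<close> recovers an exponent modulo
  \<open>2 * r\<close> from a translate of \<open>f\<close>.\<close>

locale sign_pattern =
  fixes p r :: nat and g :: int and f :: "int \<Rightarrow> int"
  assumes prime_p: "prime p" and r_pos: "r > 0"
    and f_cong: "\<And>s t. [s = t] (mod int p) \<Longrightarrow> f s = f t"
    and f_zero: "\<And>t. int p dvd t \<Longrightarrow> f t = 0"
    and f_sign: "\<And>t. \<not> int p dvd t \<Longrightarrow> f t = 1 \<or> f t = - 1"
    and f_shift: "\<And>t. f (g ^ r * t) = - f t"
    and f_minus: "\<exists>\<epsilon>. \<forall>t. f (- t) = \<epsilon> * f t"
    and generator: "\<And>t. \<not> int p dvd t \<Longrightarrow> \<exists>n. [t = g ^ n] (mod int p)"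
    and f_distinct: "\<And>a b. (\<forall>t. f (g ^ a * t) = f (g ^ b * t)) \<Longrightarrow> [a = b] (mod 2 * r)"

lemma exists_primitive_root_int:
  assumes "prime p"
  obtains g :: int where "\<not> int p dvd g"
    "\<And>t. \<not> int p dvd t \<Longrightarrow> \<exists>n. [t = g ^ n] (mod int p)"
    "\<And>a b. [g ^ a = g ^ b] (mod int p) \<longleftrightarrow> [a = b] (mod (p - 1))"
proof -
  obtain x where x: "residue_primroot p x"
    using prime_primitive_root_exists[of p] assms by (metis prime_gt_1_nat)
  then have cop: "coprime p x" and ord: "ord p x = p - 1"
    using assms by (auto simp: residue_primroot_def totient_prime)
  have p: "p > 1" using assms prime_gt_1_nat by blast
  show thesis
  proof (rule that[of "int x"])
    show "\<not> int p dvd int x" using cop p by (auto simp: coprime_absorb_left)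
    show "[int x ^ a = int x ^ b] (mod int p) \<longleftrightarrow> [a = b] (mod (p - 1))" for a b
      using order_divides_expdiff[OF cop, of a b] ord by (metis cong_int_iff of_nat_power)
    fix t assume t: "\<not> int p dvd t"
    define m where "m = nat (t mod int p)"
    have m: "int m = t mod int p" using p by (simp add: m_def)
    have "m \<noteq> 0" using t m by (auto simp: dvd_eq_mod_eq_0)
    moreover have "m < p"
      using m p by (metis of_nat_0_less_iff of_nat_less_iff pos_mod_bound less_trans zero_less_one)
    ultimately have "m \<in> totatives p" using assms by (simp add: totatives_prime)
    then have "m \<in> (\<lambda>i. x ^ i mod p) ` {..<totient p}"
      using bij_betw_imp_surj_on[OF residue_primroot_is_generator[OF p x]] by simp
    then obtain n where "x ^ n mod p = m" by blast
    then have "[int (x ^ n) = t] (mod int p)" by (metis cong_def m mod_mod_trivial of_nat_mod)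
    then show "\<exists>n. [t = int x ^ n] (mod int p)" by (metis cong_sym of_nat_power)
  qed
qed

text \<open>\<open>f\<close> is a square wave \<open>\<eta>\<close> of period \<open>2 * r\<close>
  applied to the discrete logarithm. The logarithm is determined modulo \<open>p - 1\<close>, a
  multiple of the period.\<close>

lemma sign_pattern_exists:
  assumes "prime p" "2 * r dvd p - 1" "r > 0"
  obtains g f where "sign_pattern p r g f"
proof -
  obtain g :: int where g: "\<not> int p dvd g"
    and gen: "\<And>t. \<not> int p dvd t \<Longrightarrow> \<exists>n. [t = g ^ n] (mod int p)"
    and g_eq: "\<And>a b. [g ^ a = g ^ b] (mod int p) \<longleftrightarrow> [a = b] (mod (p - 1))"
    using exists_primitive_root_int[OF assms(1)] by blast
  have pp: "prime (int p)" using assms(1) by simp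
  have gn: "\<not> int p dvd g ^ n" for n using g pp prime_dvd_power by blast
  define \<eta> where "\<eta> n = (if n mod (2 * r) < r then 1 else - 1 :: int)" for n :: nat
  define f where "f t = (if int p dvd t then 0 else \<eta> (SOME n. [t = g ^ n] (mod int p)))" for t
  have f_eq: "f t = \<eta> n" if t: "[t = g ^ n] (mod int p)" for t n
  proof -
    define k where "k = (SOME n. [t = g ^ n] (mod int p))"
    have "[t = g ^ k] (mod int p)" unfolding k_def using t by (rule someI)
    then have "[g ^ k = g ^ n] (mod int p)" using t by (metis cong_sym cong_trans)
    then have "[k = n] (mod 2 * r)" using g_eq assms(2) cong_dvd_modulus_nat by blast
    then have "\<eta> k = \<eta> n" by (simp add: \<eta>_def cong_def)
    moreover have "\<not> int p dvd t" using t gn cong_dvd_iff by blast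
    ultimately show ?thesis by (simp add: f_def k_def)
  qed
  have f_cong: "f s = f t" if "[s = t] (mod int p)" for s t
  proof (cases "int p dvd t")
    case True
    then show ?thesis using that cong_dvd_iff f_def by auto
  next
    case False
    then obtain n where n: "[t = g ^ n] (mod int p)" using gen by blast
    then show ?thesis using f_eq[OF n] f_eq[OF cong_trans[OF that n]] by simp
  qed
  have f_pow: "f (g ^ a * t) = \<eta> (a + n)" if "[t = g ^ n] (mod int p)" for a t n
    by (rule f_eq) (simp add: power_add cong_scalar_left that)
  have f_0: "f t = 0" if "int p dvd t" for t using that by (simp add: f_def)
  have \<eta>_r: "\<eta> (r + n) = - \<eta> n" for n
  proof (cases "n mod (2 * r) < r")
    case True
    then have "(r + n) mod (2 * r) = r + n mod (2 * r)"
      using assms(3) by (subst mod_add_right_eq[symmetric]) simp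
    then show ?thesis using True by (simp add: \<eta>_def)
  next
    case False
    have "n mod (2 * r) < 2 * r" using assms(3) by simp
    then have "(r + n mod (2 * r)) mod (2 * r) = (r + n mod (2 * r)) - 2 * r"
      using False by (subst mod_if) (auto simp: mod_less)
    then have "(r + n) mod (2 * r) = (r + n mod (2 * r)) - 2 * r"
      by (simp add: mod_add_right_eq)
    then show ?thesis using False \<open>n mod (2 * r) < 2 * r\<close> by (simp add: \<eta>_def)
  qed
  have f_r: "f (g ^ r * t) = - f t" for t
  proof (cases "int p dvd t")
    case False
    then obtain n where n: "[t = g ^ n] (mod int p)" using gen by blast
    then show ?thesis using f_pow[OF n] f_eq[OF n] \<eta>_r by simp
  qed (simp add: f_0)
  have "sign_pattern p r g f"
  proof
    show "f t = 1 \<or> f t = - 1" if "\<not> int p dvd t" for t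
      using that by (simp add: f_def \<eta>_def)
    show "\<exists>\<epsilon>. \<forall>t. f (- t) = \<epsilon> * f t"
    proof -
      have "\<not> int p dvd -1" using assms(1) prime_gt_1_nat[of p] by auto
      then obtain n where n: "[- 1 = g ^ n] (mod int p)" using gen by blast
      \<comment> \<open>Squaring shows that \<open>p - 1\<close> divides \<open>2 * n\<close>, hence
        \<open>r\<close> divides \<open>n\<close>, and negating the argument amounts to repeated
        shifts by \<open>g ^ r\<close>.\<close>
      then have "[(- 1) * (- 1) = g ^ n * g ^ n] (mod int p)" by (intro cong_mult)
      then have "[g ^ (2 * n) = g ^ 0] (mod int p)" by (simp add: mult_2 power_add cong_sym)
      then have "[2 * n = 0] (mod (p - 1))" by (simp only: g_eq)
      then have "(p - 1) dvd 2 * n" by (simp add: cong_0_iff)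
      then have "2 * r dvd 2 * n" using assms(2) dvd_trans by blast
      then obtain k where k: "n = r * k" by auto
      have pow: "f (g ^ (r * k) * t) = (- 1) ^ k * f t" for t
      proof (induction k)
        case (Suc k)
        have "f (g ^ (r * Suc k) * t) = f (g ^ r * (g ^ (r * k) * t))"
          by (simp add: power_add mult.assoc)
        then show ?case using Suc f_r by simp
      qed simp
      have "f (- t) = (- 1) ^ k * f t" for t
      proof -
        have "[(- 1) * t = g ^ n * t] (mod int p)" using n by (rule cong_scalar_right)
        then have "f (- t) = f (g ^ n * t)" using f_cong by simp
        then show ?thesis using pow k by simp
      qed
      then show ?thesis by blast
    qed
    show "[a = b] (mod 2 * r)" if eq: "\<forall>t. f (g ^ a * t) = f (g ^ b * t)" for a b
    proof -
      have \<eta>_eq: "\<eta> (a + n) = \<eta> (b + n)" for n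
        using eq f_pow[of "g ^ n" n] by (metis cong_refl)
      have less: "\<not> x mod (2 * r) < y mod (2 * r)"
        if xy: "\<And>n. \<eta> (x + n) = \<eta> (y + n)" for x y
      proof
        assume lt: "x mod (2 * r) < y mod (2 * r)"
        have yb: "y mod (2 * r) < 2 * r" using assms(3) by simp
        have \<eta>_red: "\<eta> (z + n) = \<eta> (z mod (2 * r) + n)" for z n
          by (simp add: \<eta>_def mod_add_left_eq)
        have \<eta>_val: "\<eta> n = (if n < r then 1 else if n < 2 * r then - 1 else 1)" if "n < 3 * r" for n
        proof (cases "n < 2 * r")
          case False
          then have "n mod (2 * r) = n - 2 * r" using that by (simp add: mod_if)
          then show ?thesis using False that by (simp add: \<eta>_def)
        qed (simp add: \<eta>_def)
        show False
        proof (cases "y mod (2 * r) < r")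
          case True
          have "\<eta> (x mod (2 * r) + (r - y mod (2 * r))) = \<eta> (y mod (2 * r) + (r - y mod (2 * r)))"
            using xy \<eta>_red by metis
          then show False using lt True by (simp add: \<eta>_val split: if_splits)
        next
          case False
          show False
          proof (cases "x mod (2 * r) < r")
            case True
            have "\<eta> (x mod (2 * r) + 0) = \<eta> (y mod (2 * r) + 0)"
              using xy \<eta>_red by metis
            then show False using True False yb by (simp add: \<eta>_val)
          next
            case False
            have "\<eta> (x mod (2 * r) + (2 * r - y mod (2 * r))) = \<eta> (y mod (2 * r) + (2 * r - y mod (2 * r)))"
              using xy \<eta>_red by metis
            then show False using lt False yb by (simp add: \<eta>_val split: if_splits)
          qed
        qed
      qed
      show ?thesis using less[of a b] less[of b a] \<eta>_eq by (auto simp: cong_def)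
    qed
  qed (use assms f_cong f_0 f_r gen in auto)
  then show thesis by (rule that)
qed

section \<open>The colouring of the product group\<close>

text \<open>For \<open>r = 3\<close> the indices of i, j, k are the residues modulo 3; for
  \<open>r = 2\<close> only j and k carry functions, and 1, 2 represent the residues modulo 2.
  \<open>Q1\<close> gets a default value.\<close>

primrec unit_index :: "quat_unit \<Rightarrow> nat" where
  "unit_index Q1 = 0"
| "unit_index Qi = 0"
| "unit_index Qj = 1"
| "unit_index Qk = 2"

section \<open>Explicit computation in the quaternion group\<close>

lemma carrier_Q8: "carrier Q8 = {1, - 1} \<times> UNIV"
  by (simp add: Q8_def)

lemma one_Q8: "\<one>\<^bsub>Q8\<^esub> = (1, Q1)"
  by (simp add: Q8_def)

lemma mult_Q8:
  "(s, u) \<otimes>\<^bsub>Q8\<^esub> (t, v) = (s * t * fst (quat_unit_mult u v), snd (quat_unit_mult u v))"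
  by (simp add: Q8_def split: prod.splits)

lemma inv_Q8:
  assumes "s \<in> {1, - 1}"
  shows "inv\<^bsub>Q8\<^esub> (s, u) = (if u = Q1 then s else - s, u)"
  by (rule group.inv_equality[OF group_Q8]) (use assms in \<open>cases u; auto simp: Q8_def\<close>)+

lemma sum_Q8:
  "(\<Sum>y\<in>carrier Q8. k y) = k (1, Q1) + k (1, Qi) + k (1, Qj) + k (1, Qk)
    + k (- 1, Q1) + k (- 1, Qi) + k (- 1, Qj) + k (- 1, Qk :: quat_unit)"
  by (simp add: carrier_Q8 UNIV_quat_unit sum.cartesian_product[symmetric] add.assoc)

lemma carrier_Q8_cases:
  assumes "q \<in> carrier Q8"
  obtains "q = (1, Q1)" | "q = (1, Qi)" | "q = (1, Qj)" | "q = (1, Qk)"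
    | "q = (- 1, Q1)" | "q = (- 1, Qi)" | "q = (- 1, Qj)" | "q = (- 1, Qk)"
  using assms by (cases q; cases "snd q") (auto simp: carrier_Q8)

text \<open>Periodicity of \<open>k\<close> lets the argument stay unreduced, which keeps later
  substitutions purely algebraic.\<close>

lemma sum_affine_reindex:
  fixes k :: "int \<Rightarrow> int"
  assumes "prime p" "\<not> int p dvd c"
    and per: "\<And>s t. [s = t] (mod int p) \<Longrightarrow> k s = k t"
  shows "(\<Sum>s\<in>{0..<int p}. k (c * s + d)) = (\<Sum>s\<in>{0..<int p}. k s)"
proof -
  let ?m = "\<lambda>s. (c * s + d) mod int p"
  have p: "p > 0" using assms(1) prime_gt_0_nat by blast
  have "inj_on ?m {0..<int p}"
  proof (rule inj_onI)
    fix s t assume st: "s \<in> {0..<int p}" "t \<in> {0..<int p}" "?m s = ?m t"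
    then have "int p dvd c * (s - t)" by (simp add: mod_eq_dvd_iff algebra_simps)
    then have "int p dvd s - t" using assms(1,2) by (simp add: prime_dvd_mult_iff)
    then have "s mod int p = t mod int p" by (simp add: mod_eq_dvd_iff)
    then show "s = t" using st by simp
  qed
  moreover have "?m ` {0..<int p} \<subseteq> {0..<int p}" using p by auto
  ultimately have "bij_betw ?m {0..<int p} {0..<int p}"
    by (metis bij_betw_def card_image card_subset_eq finite_atLeastLessThan_int)
  then have "(\<Sum>s\<in>{0..<int p}. k (?m s)) = (\<Sum>s\<in>{0..<int p}. k s)"
    by (rule sum.reindex_bij_betw)
  moreover have "k (?m s) = k (c * s + d)" for s by (rule per) (simp add: cong_def)
  ultimately show ?thesis by simp
qed

section \<open>The colouring attached to a sign pattern\<close>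

locale quaternion_pattern = sign_pattern +
  assumes r_cases: "r = 2 \<or> r = 3"
begin

text \<open>As \<open>r\<close> is 2 or 3, \<open>odd r\<close> means \<open>r = 3\<close>; in both
  cases exactly \<open>r\<close> imaginary units are active.\<close>

definition active :: "quat_unit \<Rightarrow> bool" where
  "active u \<longleftrightarrow> u = Qj \<or> u = Qk \<or> u = Qi \<and> odd r"

definition \<phi> :: "int \<times> quat_unit \<Rightarrow> int \<Rightarrow> int" where
  "\<phi> q t = (if active (snd q) then fst q * f (g ^ unit_index (snd q) * t) else 0)"

text \<open>The labels are \<open>\<plusminus>1\<close> for the central elements, 3 for the units that carry a sign function, and
  2 for \<open>\<plusminus>i\<close> when \<open>r = 2\<close>.\<close>

definition cls :: "int \<times> quat_unit \<Rightarrow> int" where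
  "cls q = (if snd q = Q1 then fst q else if active (snd q) then 3 else 2)"

text \<open>The flag separates residue 0 over units where \<open>\<phi>\<close> vanishes
  identically; over active units the sign of \<open>\<phi>\<close> splits the nonzero
  residues.\<close>

definition col :: "(int \<times> quat_unit) \<times> int \<Rightarrow> int \<times> bool \<times> int" where
  "col x = (cls (fst x), snd x = 0, \<phi> (fst x) (snd x))"

text \<open>\<open>Qj\<close> represents label 3 because it is active for both values of
  \<open>r\<close>; label 2 is attained only for \<open>r = 2\<close>.\<close>

definition cls_rep :: "int \<Rightarrow> int \<times> quat_unit" where
  "cls_rep c = (if c = 1 then (1, Q1) else if c = - 1 then (- 1, Q1)
     else if c = 2 then (1, Qi) else (1, Qj))"

abbreviation (input) Z\<^sub>p :: "int set" where "Z\<^sub>p \<equiv> {0..<int p}"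

definition conv :: "int \<times> quat_unit \<Rightarrow> int \<times> quat_unit \<Rightarrow> int \<Rightarrow> int" where
  "conv y z t = (\<Sum>s\<in>Z\<^sub>p. \<phi> y s * \<phi> z (t - s))"

section \<open>Sums and convolutions of the sign functions\<close>

lemma active_simps [simp]: "\<not> active Q1" "active Qi \<longleftrightarrow> odd r" "active Qj" "active Qk"
  by (auto simp: active_def)

lemma p_gt_1: "p > 1"
  using prime_p prime_gt_1_nat by blast

lemma not_dvd_1: "\<not> int p dvd 1"
  using p_gt_1 by simp

text \<open>\<open>f_shift\<close> forces \<open>g\<close> to be a unit modulo \<open>p\<close>,
  since \<open>f (g ^ r) = - f 1\<close> is nonzero.\<close>

lemma not_dvd_g: "\<not> int p dvd g ^ n"
proof -
  have "f (g ^ r * 1) \<noteq> 0" using f_shift[of 1] f_sign[OF not_dvd_1] by auto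
  then have "\<not> int p dvd g ^ r" using f_zero[of "g ^ r * 1"] by auto
  then have "\<not> int p dvd g" using r_pos by (auto simp: dvd_power_le intro: dvd_trans[OF _ dvd_power])
  then show ?thesis using prime_p prime_dvd_power[of "int p" g n] by auto
qed

lemma cls_cls_rep: "q \<in> carrier Q8 \<Longrightarrow> cls (cls_rep (cls q)) = cls q"
  by (erule carrier_Q8_cases) (auto simp: cls_def cls_rep_def)

lemma cls_rep_closed: "cls_rep c \<in> carrier Q8"
  by (simp add: cls_rep_def carrier_Q8)

lemma phi_cong: "[s = t] (mod int p) \<Longrightarrow> \<phi> q s = \<phi> q t"
  using f_cong[OF cong_scalar_left] by (simp add: \<phi>_def)

lemma phi_mod: "\<phi> q (t mod int p) = \<phi> q t"
  by (rule phi_cong) (simp add: cong_def)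

lemma phi_0: "\<phi> q 0 = 0"
  using f_zero[of 0] by (simp add: \<phi>_def)

lemma phi_sign: "\<phi> (s, u) t = s * \<phi> (1, u) t"
  by (simp add: \<phi>_def)

lemma phi_neg: "\<phi> (- 1, u) t = - \<phi> (1, u) t"
  by (simp add: \<phi>_def)

lemma phi_Q1: "\<phi> (s, Q1) t = 0"
  by (simp add: \<phi>_def)

text \<open>Multiplication by \<open>g ^ r\<close> permutes the residues and reverses the sign of
  \<open>\<phi>\<close>.\<close>

lemma sum_phi: "(\<Sum>s\<in>Z\<^sub>p. \<phi> q s) = 0"
proof -
  have "(\<Sum>s\<in>Z\<^sub>p. \<phi> q (g ^ r * s + 0)) = (\<Sum>s\<in>Z\<^sub>p. \<phi> q s)"
    by (rule sum_affine_reindex[OF prime_p not_dvd_g phi_cong])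
  moreover have "\<phi> q (g ^ r * s) = - \<phi> q s" for s
    using f_shift[of "g ^ unit_index (snd q) * s"] by (simp add: \<phi>_def mult.left_commute)
  ultimately show ?thesis by (simp add: sum_negf)
qed

lemma sum_phi_diff: "(\<Sum>s\<in>Z\<^sub>p. \<phi> q (t - s)) = 0"
proof -
  have "(\<Sum>s\<in>Z\<^sub>p. \<phi> q (- 1 * s + t)) = (\<Sum>s\<in>Z\<^sub>p. \<phi> q s)"
    using p_gt_1 by (intro sum_affine_reindex[OF prime_p _ phi_cong]) auto
  then show ?thesis using sum_phi[of q] by simp
qed

lemma conv_commute: "conv y z t = conv z y t"
proof -
  have "(\<Sum>s\<in>Z\<^sub>p. \<phi> y (- 1 * s + t) * \<phi> z (t - (- 1 * s + t))) = (\<Sum>s\<in>Z\<^sub>p. \<phi> y s * \<phi> z (t - s))"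
  proof (rule sum_affine_reindex[OF prime_p])
    show "\<not> int p dvd - 1" using p_gt_1 by auto
    fix s s' :: int assume "[s = s'] (mod int p)"
    then show "\<phi> y s * \<phi> z (t - s) = \<phi> y s' * \<phi> z (t - s')"
      by (intro arg_cong2[of _ _ _ _ "(*)"] phi_cong cong_diff) auto
  qed
  then show ?thesis by (simp add: conv_def mult.commute)
qed

lemma conv_sign: "conv (s, u) (s', v) t = s * s' * conv (1, u) (1, v) t"
  unfolding conv_def sum_distrib_left
  by (rule sum.cong[OF refl]) (simp add: phi_sign[of s] phi_sign[of s'])

lemma conv_Q1: "conv (s, Q1) z t = 0" "conv z (s, Q1) t = 0"
  by (simp_all add: conv_def phi_Q1)

definition autocorr :: "int \<Rightarrow> int" where
  "autocorr t = conv (1, Qi) (1, Qi) t + conv (1, Qj) (1, Qj) t + conv (1, Qk) (1, Qk) t"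

lemma conv_diagonal:
  assumes "active u"
  shows "conv (1, u) (1, u) t = (\<Sum>s\<in>Z\<^sub>p. f s * f (g ^ unit_index u * t - s))"
proof -
  have "(\<Sum>s\<in>Z\<^sub>p. f (g ^ unit_index u * s + 0) * f (g ^ unit_index u * t - (g ^ unit_index u * s + 0)))
      = (\<Sum>s\<in>Z\<^sub>p. f s * f (g ^ unit_index u * t - s))"
  proof (rule sum_affine_reindex[OF prime_p not_dvd_g])
    fix s s' :: int assume "[s = s'] (mod int p)"
    then show "f s * f (g ^ unit_index u * t - s) = f s' * f (g ^ unit_index u * t - s')"
      by (intro arg_cong2[of _ _ _ _ "(*)"] f_cong cong_diff) auto
  qed
  then show ?thesis using assms by (simp add: conv_def \<phi>_def right_diff_distrib)
qed

text \<open>The autocorrelation \<open>k\<close> of \<open>f\<close> is invariant under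
  \<open>g ^ r\<close> because two sign changes cancel. Thus \<open>autocorr\<close> sums
  \<open>k\<close> over a full cycle of \<open>r\<close> translates, which multiplication by
  \<open>g\<close> rotates.\<close>

lemma autocorr_shift: "autocorr (g * t) = autocorr t"
proof -
  define k where "k x = (\<Sum>s\<in>Z\<^sub>p. f s * f (x - s))" for x
  have k_r: "k (g ^ r * x) = k x" for x
  proof -
    have "(\<Sum>s\<in>Z\<^sub>p. f (g ^ r * s + 0) * f (g ^ r * x - (g ^ r * s + 0))) = k (g ^ r * x)"
      unfolding k_def
    proof (rule sum_affine_reindex[OF prime_p not_dvd_g])
      fix s s' :: int assume "[s = s'] (mod int p)"
      then show "f s * f (g ^ r * x - s) = f s' * f (g ^ r * x - s')"
        by (intro arg_cong2[of _ _ _ _ "(*)"] f_cong cong_diff) auto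
    qed
    then show ?thesis by (simp add: k_def f_shift flip: right_diff_distrib)
  qed
  have conv_k: "conv (1, u) (1, u) t = (if active u then k (g ^ unit_index u * t) else 0)" for u t
    using conv_diagonal[of u t] by (auto simp: k_def conv_def \<phi>_def)
  show ?thesis
  proof (cases "odd r")
    case True
    then have "r = 3" using r_cases by auto
    then have "k (g ^ 3 * t) = k t" using k_r[of t] by simp
    then show ?thesis using True unfolding autocorr_def conv_k
      by (simp add: power2_eq_square power3_eq_cube mult.assoc)
  next
    case False
    then have "r = 2" using r_cases by auto
    \<comment> \<open>The active indices are 1 and 2, so the term that wraps around is the one at
      \<open>g ^ 3\<close>, and it returns to \<open>g\<close>.\<close>
    then have "k (g ^ 2 * (g * t)) = k (g * t)" using k_r[of "g * t"] by simp
    then show ?thesis using False unfolding autocorr_def conv_k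
      by (simp add: power2_eq_square mult.assoc)
  qed
qed

lemma autocorr_cong: "[s = t] (mod int p) \<Longrightarrow> autocorr s = autocorr t"
  unfolding autocorr_def conv_def
  by (intro arg_cong2[of _ _ _ _ "(+)"] arg_cong2[of _ _ _ _ "(*)"] sum.cong phi_cong cong_diff) auto

lemma autocorr_eq:
  assumes "\<not> int p dvd t"
  shows "autocorr t = autocorr 1"
proof -
  obtain n where "[t = g ^ n] (mod int p)" using generator[OF assms] by blast
  moreover have "autocorr (g ^ n) = autocorr 1" by (induction n) (simp_all add: autocorr_shift)
  ultimately show ?thesis using autocorr_cong by simp
qed

text \<open>Labels agree on an imaginary unit and its negative while \<open>\<phi>\<close> changes
  sign, so only the two central elements contribute.\<close>

lemma class_conv_phi:
  assumes "q \<in> carrier Q8"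
  shows "(\<Sum>y\<in>carrier Q8. A (cls y) * \<phi> (inv\<^bsub>Q8\<^esub> y \<otimes>\<^bsub>Q8\<^esub> q) t) = (A 1 - A (- 1)) * \<phi> q t"
  using assms
  by (rule carrier_Q8_cases)
    (simp_all add: sum_Q8 inv_Q8 mult_Q8 cls_def phi_Q1 phi_neg algebra_simps)

lemma phi_conv_class:
  assumes "q \<in> carrier Q8"
  shows "(\<Sum>y\<in>carrier Q8. \<phi> y t * A (cls (inv\<^bsub>Q8\<^esub> y \<otimes>\<^bsub>Q8\<^esub> q))) = (A 1 - A (- 1)) * \<phi> q t"
  using assms
  by (rule carrier_Q8_cases)
    (simp_all add: sum_Q8 inv_Q8 mult_Q8 cls_def phi_Q1 phi_neg algebra_simps)

text \<open>The off-diagonal terms cancel because distinct imaginary units anticommute.\<close>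

lemma phi_conv_phi:
  assumes "q \<in> carrier Q8"
  shows "(\<Sum>y\<in>carrier Q8. conv y (inv\<^bsub>Q8\<^esub> y \<otimes>\<^bsub>Q8\<^esub> q) t)
    = (if snd q = Q1 then - 2 * fst q * autocorr t else 0)"
proof -
  \<comment> \<open>Signs are pulled out and the units of each pair put in a fixed order, after
    which anticommuting pairs cancel by arithmetic.\<close>
  note sign = conv_sign[of "- 1"] conv_sign[of 1 _ "- 1"]
  note comm = conv_commute[of "(1, Qj)" "(1, Qi)"] conv_commute[of "(1, Qk)" "(1, Qi)"]
    conv_commute[of "(1, Qk)" "(1, Qj)"]
  show ?thesis using assms
    by (rule carrier_Q8_cases)
      (simp_all add: sum_Q8 inv_Q8 mult_Q8 conv_Q1 sign comm autocorr_def)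
qed

text \<open>The fibres of \<open>cls\<close> are the orbits of a group of automorphisms of the
  quaternion group, so convolutions of label functions depend on the label only.\<close>

lemma class_conv_class:
  assumes "q \<in> carrier Q8"
  shows "(\<Sum>y\<in>carrier Q8. A (cls y) * B (cls (inv\<^bsub>Q8\<^esub> y \<otimes>\<^bsub>Q8\<^esub> q)))
    = (\<Sum>y\<in>carrier Q8. A (cls y) * (B (cls (inv\<^bsub>Q8\<^esub> y \<otimes>\<^bsub>Q8\<^esub> cls_rep (cls q))) :: int))"
  using assms
  by (rule carrier_Q8_cases)
    (simp_all add: sum_Q8 inv_Q8 mult_Q8 cls_def cls_rep_def)

section \<open>Arithmetic in the direct product\<close>

abbreviation (input) G :: "((int \<times> quat_unit) \<times> int) monoid" where
  "G \<equiv> Q8 \<times>\<times> integer_mod_group p"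

lemma carrier_G: "carrier G = carrier Q8 \<times> Z\<^sub>p"
  using p_gt_1 by (simp add: carrier_integer_mod_group)

lemma group_G: "group G"
  by (rule group_Q8_times_integer_mod_group)

lemma finite_G: "finite (carrier G)"
  using p_gt_1 by (intro finite_Q8_times_integer_mod_group) simp

lemma mult_G: "(q, s) \<otimes>\<^bsub>G\<^esub> (q', s') = (q \<otimes>\<^bsub>Q8\<^esub> q', (s + s') mod int p)"
  by simp

lemma inv_G:
  assumes "q \<in> carrier Q8" "s \<in> Z\<^sub>p"
  shows "inv\<^bsub>G\<^esub> (q, s) = (inv\<^bsub>Q8\<^esub> q, (- s) mod int p)"
proof (rule group.inv_equality[OF group_G])
  interpret Q: group Q8 by (rule group_Q8)
  show "(inv\<^bsub>Q8\<^esub> q, (- s) mod int p) \<otimes>\<^bsub>G\<^esub> (q, s) = \<one>\<^bsub>G\<^esub>"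
    using assms by (simp add: one_DirProd mod_add_left_eq)
  show "(q, s) \<in> carrier G" "(inv\<^bsub>Q8\<^esub> q, (- s) mod int p) \<in> carrier G"
    using assms p_gt_1 unfolding carrier_G by auto
qed

lemma quotient_G:
  assumes "q \<in> carrier Q8" "s \<in> Z\<^sub>p"
  shows "inv\<^bsub>G\<^esub> (q, s) \<otimes>\<^bsub>G\<^esub> (q', s') = (inv\<^bsub>Q8\<^esub> q \<otimes>\<^bsub>Q8\<^esub> q', (s' - s) mod int p)"
    "(q', s') \<otimes>\<^bsub>G\<^esub> inv\<^bsub>G\<^esub> (q, s) = (q' \<otimes>\<^bsub>Q8\<^esub> inv\<^bsub>Q8\<^esub> q, (s' - s) mod int p)"
  unfolding inv_G[OF assms] mult_G by (simp_all add: mod_simps)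

section \<open>Class functions and their convolutions\<close>

lemma cls_eq_1: "q \<in> carrier Q8 \<Longrightarrow> cls q = 1 \<longleftrightarrow> q = (1, Q1)"
  by (erule carrier_Q8_cases) (auto simp: cls_def)

lemma cls_eq_3: "q \<in> carrier Q8 \<Longrightarrow> cls q = 3 \<longleftrightarrow> active (snd q)"
  by (erule carrier_Q8_cases) (auto simp: cls_def)

lemma phi_active:
  assumes "q \<in> carrier Q8" "active (snd q)" "\<not> int p dvd t"
  shows "\<phi> q t = 1 \<or> \<phi> q t = - 1"
proof -
  have "\<not> int p dvd g ^ unit_index (snd q) * t"
    using prime_p assms(3) not_dvd_g by (simp add: prime_dvd_mult_iff)
  then show ?thesis using f_sign assms by (fastforce simp: \<phi>_def carrier_Q8)
qed

lemma not_dvd_Zp: "t \<in> Z\<^sub>p \<Longrightarrow> t \<noteq> 0 \<Longrightarrow> \<not> int p dvd t"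
  by (auto dest: zdvd_imp_le)

text \<open>The factor 2 on the left keeps the coefficients integral.\<close>

lemma class_function_decomposition:
  fixes h :: "(int \<times> quat_unit) \<times> int \<Rightarrow> int"
  assumes h: "\<And>x y. x \<in> carrier G \<Longrightarrow> y \<in> carrier G \<Longrightarrow> col x = col y \<Longrightarrow> h x = h y"
  obtains A B \<gamma> where "\<And>q t. q \<in> carrier Q8 \<Longrightarrow> t \<in> Z\<^sub>p \<Longrightarrow>
    2 * h (q, t) = (if t = 0 then A (cls q) else 0) + B (cls q) + \<gamma> * \<phi> q t"
proof -
  \<comment> \<open>A sample element with label 3 at which \<open>\<phi>\<close> equals
    \<open>s\<close>: the factor \<open>f g\<close> cancels the value of \<open>f\<close> at
    \<open>g ^ unit_index Qj\<close>.\<close>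
  define x where "x s = ((s * f g, Qj), 1 :: int)" for s :: int
  have fg: "f g = 1 \<or> f g = - 1" using f_sign not_dvd_g[of 1] by simp
  have xG: "x s \<in> carrier G" if "s \<in> {1, - 1}" for s
    using that fg p_gt_1 unfolding carrier_G by (auto simp: x_def carrier_Q8)
  have col_x: "col (x s) = (3, False, s)" if "s \<in> {1, - 1}" for s
    using that fg by (auto simp: col_def x_def cls_def \<phi>_def)
  \<comment> \<open>Over active units, \<open>\<gamma>\<close> and \<open>B\<close> are the
    difference and the sum of the two values taken on nonzero residues; \<open>A\<close> corrects
    the value at residue 0.\<close>
  define \<gamma> where "\<gamma> = h (x 1) - h (x (- 1))"
  define B where "B c = (if c = 3 then h (x 1) + h (x (- 1)) else 2 * h (cls_rep c, 1))" for c
  define A where "A c = 2 * h (cls_rep c, 0) - B c" for c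
  show thesis
  proof (rule that)
    fix q t assume q: "q \<in> carrier Q8" and t: "t \<in> Z\<^sub>p"
    have G: "(q, t) \<in> carrier G" using q t unfolding carrier_G by simp
    have rep: "(cls_rep (cls q), c) \<in> carrier G" if "c \<in> {0, 1}" for c
      using that p_gt_1 cls_rep_closed unfolding carrier_G by auto
    show "2 * h (q, t) = (if t = 0 then A (cls q) else 0) + B (cls q) + \<gamma> * \<phi> q t"
    proof (cases "t = 0")
      case True
      have "h (q, t) = h (cls_rep (cls q), 0)"
        using G rep by (rule h) (auto simp: col_def True phi_0 cls_cls_rep[OF q])
      then show ?thesis by (simp add: True A_def phi_0)
    next
      case t0: False
      show ?thesis
      proof (cases "active (snd q)")
        case True
        then have c3: "cls q = 3" using cls_eq_3[OF q] by simp
        have "\<phi> q t = 1 \<or> \<phi> q t = - 1" using phi_active[OF q True] not_dvd_Zp[OF t t0] by blast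
        then have s: "\<phi> q t \<in> {1, - 1}" by simp
        have "h (q, t) = h (x (\<phi> q t))"
          using G xG[OF s] by (rule h) (use col_x[OF s] c3 t0 in \<open>simp add: col_def\<close>)
        then show ?thesis using s t0 c3 by (auto simp: B_def \<gamma>_def)
      next
        case False
        then have c3: "cls q \<noteq> 3" using cls_eq_3[OF q] by simp
        then have na: "\<not> active (snd (cls_rep (cls q)))"
          using cls_eq_3[OF cls_rep_closed] cls_cls_rep[OF q] by metis
        have "h (q, t) = h (cls_rep (cls q), 1)"
          using G rep by (rule h) (use na False t0 in \<open>auto simp: col_def \<phi>_def cls_cls_rep[OF q]\<close>)
        then show ?thesis using t0 c3 False by (simp add: B_def \<phi>_def)
      qed
    qed
  qed
qed

text \<open>Each factor is a point mass at 0 plus a constant plus a multiple of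
  \<open>\<phi>\<close>; products of a constant with \<open>\<phi>\<close> disappear because
  \<open>\<phi>\<close> sums to zero.\<close>

lemma inner_convolution:
  assumes t: "t \<in> Z\<^sub>p"
  shows "(\<Sum>s\<in>Z\<^sub>p. ((if s = 0 then a else 0) + b + c * \<phi> y s)
      * ((if (t - s) mod int p = 0 then a' else 0) + b' + c' * \<phi> z ((t - s) mod int p)))
    = (if t = 0 then a * a' else 0) + a * b' + b * a' + int p * (b * b')
      + c' * (a * \<phi> z t) + c * (\<phi> y t * a') + c * c' * conv y z t"
proof -
  have z0: "0 \<in> Z\<^sub>p" using p_gt_1 by simp
  have eq: "(t - s) mod int p = 0 \<longleftrightarrow> s = t" if "s \<in> Z\<^sub>p" for s
    using that t by (simp add: mod_eq_0_iff_dvd flip: mod_eq_dvd_iff) (auto simp: eq_commute)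
  have "(\<Sum>s\<in>Z\<^sub>p. ((if s = 0 then a else 0) + b + c * \<phi> y s)
      * ((if (t - s) mod int p = 0 then a' else 0) + b' + c' * \<phi> z ((t - s) mod int p)))
    = (\<Sum>s\<in>Z\<^sub>p. (if s = 0 then a * ((if t = 0 then a' else 0) + b' + c' * \<phi> z t) else 0)
        + (if s = t then (b + c * \<phi> y t) * a' else 0)
        + b * b' + c * b' * \<phi> y s + b * c' * \<phi> z (t - s) + c * c' * (\<phi> y s * \<phi> z (t - s)))"
  proof (rule sum.cong[OF refl])
    fix s assume "s \<in> Z\<^sub>p"
    then show "((if s = 0 then a else 0) + b + c * \<phi> y s)
      * ((if (t - s) mod int p = 0 then a' else 0) + b' + c' * \<phi> z ((t - s) mod int p))
      = (if s = 0 then a * ((if t = 0 then a' else 0) + b' + c' * \<phi> z t) else 0)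
        + (if s = t then (b + c * \<phi> y t) * a' else 0)
        + b * b' + c * b' * \<phi> y s + b * c' * \<phi> z (t - s) + c * c' * (\<phi> y s * \<phi> z (t - s))"
      using eq[of s] by (auto simp: phi_mod algebra_simps)
  qed
  also have "\<dots> = a * ((if t = 0 then a' else 0) + b' + c' * \<phi> z t) + (b + c * \<phi> y t) * a'
      + int p * (b * b') + c * b' * (\<Sum>s\<in>Z\<^sub>p. \<phi> y s) + b * c' * (\<Sum>s\<in>Z\<^sub>p. \<phi> z (t - s))
      + c * c' * conv y z t"
    using t z0 by (simp add: sum.distrib sum_distrib_left conv_def)
  finally show ?thesis by (simp add: sum_phi sum_phi_diff algebra_simps)
qed

text \<open>After decomposing both functions, four times the convolution is an expression
  \<open>E\<close> in the colour alone; the factor 4 comes from the two doublings and cancels over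
  the integers.\<close>

lemma convolution_class_function:
  fixes h h' :: "(int \<times> quat_unit) \<times> int \<Rightarrow> int"
  assumes h: "\<And>x y. x \<in> carrier G \<Longrightarrow> y \<in> carrier G \<Longrightarrow> col x = col y \<Longrightarrow> h x = h y"
    and h': "\<And>x y. x \<in> carrier G \<Longrightarrow> y \<in> carrier G \<Longrightarrow> col x = col y \<Longrightarrow> h' x = h' y"
    and xy: "x \<in> carrier G" "y \<in> carrier G" "col x = col y"
  shows "(\<Sum>z\<in>carrier G. h z * h' (inv\<^bsub>G\<^esub> z \<otimes>\<^bsub>G\<^esub> x))
    = (\<Sum>z\<in>carrier G. h z * h' (inv\<^bsub>G\<^esub> z \<otimes>\<^bsub>G\<^esub> y))"
proof -
  interpret Q: group Q8 by (rule group_Q8)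
  obtain A B \<gamma> where dec: "\<And>q t. q \<in> carrier Q8 \<Longrightarrow> t \<in> Z\<^sub>p \<Longrightarrow>
    2 * h (q, t) = (if t = 0 then A (cls q) else 0) + B (cls q) + \<gamma> * \<phi> q t"
    using class_function_decomposition[of h] h by blast
  obtain A' B' \<gamma>' where dec': "\<And>q t. q \<in> carrier Q8 \<Longrightarrow> t \<in> Z\<^sub>p \<Longrightarrow>
    2 * h' (q, t) = (if t = 0 then A' (cls q) else 0) + B' (cls q) + \<gamma>' * \<phi> q t"
    using class_function_decomposition[of h'] h' by blast
  define P where "P C D c = (\<Sum>y\<in>carrier Q8. C (cls y) * D (cls (inv\<^bsub>Q8\<^esub> y \<otimes>\<^bsub>Q8\<^esub> cls_rep c)))"
    for C D :: "int \<Rightarrow> int" and c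
  \<comment> \<open>Here \<open>c\<close> is the label, \<open>z\<close> the flag for residue 0 and
    \<open>v\<close> the value of \<open>\<phi>\<close>. The flag suffices for
    \<open>autocorr\<close>, which is constant on nonzero residues.\<close>
  define E where "E k = (case k of (c :: int, z, v) \<Rightarrow> (if z then P A A' c else 0)
      + P A B' c + P B A' c + int p * P B B' c
      + (\<gamma>' * (A 1 - A (- 1)) + \<gamma> * (A' 1 - A' (- 1))) * v
      + \<gamma> * \<gamma>' * (if c = 1 \<or> c = - 1 then - 2 * c * autocorr (if z then 0 else 1) else 0))" for k
  have main: "4 * (\<Sum>z\<in>carrier G. h z * h' (inv\<^bsub>G\<^esub> z \<otimes>\<^bsub>G\<^esub> (q, t))) = E (col (q, t))"
    if q: "q \<in> carrier Q8" and t: "t \<in> Z\<^sub>p" for q t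
  proof -
    have "4 * (\<Sum>z\<in>carrier G. h z * h' (inv\<^bsub>G\<^esub> z \<otimes>\<^bsub>G\<^esub> (q, t)))
      = (\<Sum>z\<in>carrier G. (2 * h z) * (2 * h' (inv\<^bsub>G\<^esub> z \<otimes>\<^bsub>G\<^esub> (q, t))))"
      by (simp add: sum_distrib_left mult_ac)
    also have "\<dots> = (\<Sum>y\<in>carrier Q8. \<Sum>s\<in>Z\<^sub>p.
        (2 * h (y, s)) * (2 * h' (inv\<^bsub>G\<^esub> (y, s) \<otimes>\<^bsub>G\<^esub> (q, t))))"
      unfolding carrier_G by (simp only: sum.cartesian_product case_prod_unfold prod.collapse)
    also have "\<dots> = (\<Sum>y\<in>carrier Q8. \<Sum>s\<in>Z\<^sub>p.
        ((if s = 0 then A (cls y) else 0) + B (cls y) + \<gamma> * \<phi> y s)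
        * ((if (t - s) mod int p = 0 then A' (cls (inv\<^bsub>Q8\<^esub> y \<otimes>\<^bsub>Q8\<^esub> q)) else 0)
            + B' (cls (inv\<^bsub>Q8\<^esub> y \<otimes>\<^bsub>Q8\<^esub> q))
            + \<gamma>' * \<phi> (inv\<^bsub>Q8\<^esub> y \<otimes>\<^bsub>Q8\<^esub> q) ((t - s) mod int p)))"
    proof (intro sum.cong refl)
      fix y s assume y: "y \<in> carrier Q8" and s: "s \<in> Z\<^sub>p"
      have "inv\<^bsub>Q8\<^esub> y \<otimes>\<^bsub>Q8\<^esub> q \<in> carrier Q8" using y q by simp
      moreover have "(t - s) mod int p \<in> Z\<^sub>p" using p_gt_1 by simp
      ultimately show "(2 * h (y, s)) * (2 * h' (inv\<^bsub>G\<^esub> (y, s) \<otimes>\<^bsub>G\<^esub> (q, t)))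
        = ((if s = 0 then A (cls y) else 0) + B (cls y) + \<gamma> * \<phi> y s)
        * ((if (t - s) mod int p = 0 then A' (cls (inv\<^bsub>Q8\<^esub> y \<otimes>\<^bsub>Q8\<^esub> q)) else 0)
            + B' (cls (inv\<^bsub>Q8\<^esub> y \<otimes>\<^bsub>Q8\<^esub> q))
            + \<gamma>' * \<phi> (inv\<^bsub>Q8\<^esub> y \<otimes>\<^bsub>Q8\<^esub> q) ((t - s) mod int p))"
        unfolding quotient_G(1)[OF y s] using dec[OF y s] dec' by simp
    qed
    also have "\<dots> = (if t = 0 then P A A' (cls q) else 0) + P A B' (cls q) + P B A' (cls q)
        + int p * P B B' (cls q)
        + \<gamma>' * (\<Sum>y\<in>carrier Q8. A (cls y) * \<phi> (inv\<^bsub>Q8\<^esub> y \<otimes>\<^bsub>Q8\<^esub> q) t)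
        + \<gamma> * (\<Sum>y\<in>carrier Q8. \<phi> y t * A' (cls (inv\<^bsub>Q8\<^esub> y \<otimes>\<^bsub>Q8\<^esub> q)))
        + \<gamma> * \<gamma>' * (\<Sum>y\<in>carrier Q8. conv y (inv\<^bsub>Q8\<^esub> y \<otimes>\<^bsub>Q8\<^esub> q) t)"
      unfolding inner_convolution[OF t] P_def class_conv_class[OF q, symmetric]
      by (simp add: sum.distrib sum_distrib_left)
    also have "\<dots> = E (col (q, t))"
    proof -
      have "autocorr t = autocorr (if t = 0 then 0 else 1)"
        using autocorr_eq not_dvd_Zp[OF t] by simp
      moreover have "cls q = 1 \<or> cls q = - 1 \<longleftrightarrow> snd q = Q1" "snd q = Q1 \<Longrightarrow> cls q = fst q"
        using q by (auto simp: cls_def carrier_Q8)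
      ultimately show ?thesis
        unfolding class_conv_phi[OF q] phi_conv_class[OF q] phi_conv_phi[OF q] E_def col_def
        by (simp add: algebra_simps)
    qed
    finally show ?thesis .
  qed
  obtain q t q' t' where "x = (q, t)" "y = (q', t')" by (cases x, cases y)
  then show ?thesis using main[of q t] main[of q' t'] xy unfolding carrier_G by simp
qed

lemma s_ring_colour: "s_ring G (int_span (indicator ` colour_classes G col))"
proof (rule s_ring_of_colouring[OF group_G finite_G])
  fix x assume "x \<in> carrier G" "col x = col \<one>\<^bsub>G\<^esub>"
  then show "x = \<one>\<^bsub>G\<^esub>"
    using cls_eq_1[of "fst x"] unfolding carrier_G
    by (auto simp: col_def one_Q8 cls_def split: if_splits)
next
  obtain \<epsilon> where \<epsilon>: "\<And>t. f (- t) = \<epsilon> * f t" using f_minus by blast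
  \<comment> \<open>Inverting an imaginary unit changes its sign and negating the residue
    contributes \<open>\<epsilon>\<close>, so inversion multiplies \<open>\<phi>\<close> by one
    global constant.\<close>
  have col_inv: "col (inv\<^bsub>G\<^esub> (q, t)) = (cls q, t = 0, - \<epsilon> * \<phi> q t)"
    if q: "q \<in> carrier Q8" and t: "t \<in> Z\<^sub>p" for q t
  proof -
    have "cls (inv\<^bsub>Q8\<^esub> q) = cls q" using q by (rule carrier_Q8_cases) (simp_all add: inv_Q8 cls_def)
    moreover have "\<phi> (inv\<^bsub>Q8\<^esub> q) (- t) = - \<epsilon> * \<phi> q t"
      using q by (rule carrier_Q8_cases) (simp_all add: inv_Q8 \<phi>_def \<epsilon>)
    moreover have "(- t) mod int p = 0 \<longleftrightarrow> t = 0"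
      using t not_dvd_Zp[of t] by (auto simp: mod_eq_0_iff_dvd)
    ultimately show ?thesis unfolding inv_G[OF q t] by (simp add: col_def phi_mod)
  qed
  fix x y assume "x \<in> carrier G" "y \<in> carrier G" "col x = col y"
  then show "col (inv\<^bsub>G\<^esub> x) = col (inv\<^bsub>G\<^esub> y)"
    unfolding carrier_G by (cases x; cases y) (simp add: col_inv, simp add: col_def)
next
  show "(\<Sum>z\<in>carrier G. h z * h' (inv\<^bsub>G\<^esub> z \<otimes>\<^bsub>G\<^esub> x)) = (\<Sum>z\<in>carrier G. h z * h' (inv\<^bsub>G\<^esub> z \<otimes>\<^bsub>G\<^esub> y))"
    if "\<And>x y. x \<in> carrier G \<Longrightarrow> y \<in> carrier G \<Longrightarrow> col x = col y \<Longrightarrow> h x = h y"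
      "\<And>x y. x \<in> carrier G \<Longrightarrow> y \<in> carrier G \<Longrightarrow> col x = col y \<Longrightarrow> h' x = h' y"
      "x \<in> carrier G" "y \<in> carrier G" "col x = col y"
    for h h' :: "(int \<times> quat_unit) \<times> int \<Rightarrow> int" and x y
    using convolution_class_function[OF that] .
qed

subsection \<open>Failure of schurity\<close>

text \<open>A negative sign counts as a shift by \<open>r\<close>. Modulo \<open>2 * r\<close> each
  exponent then belongs to exactly one signed active unit, which is the cyclic order of these
  units.\<close>

definition expo :: "int \<times> quat_unit \<Rightarrow> nat" where
  "expo q = unit_index (snd q) + (if fst q = 1 then 0 else r)"

lemma phi_expo:
  assumes "q \<in> carrier Q8" "active (snd q)"
  shows "\<phi> q t = f (g ^ expo q * t)"
proof -
  have "f (g ^ (unit_index (snd q) + r) * t) = - f (g ^ unit_index (snd q) * t)"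
    using f_shift[of "g ^ unit_index (snd q) * t"] by (simp add: power_add mult_ac)
  then show ?thesis using assms by (auto simp: \<phi>_def expo_def carrier_Q8)
qed

section \<open>Residue permutations compatible with the sign function\<close>

lemma inverse_mod_p:
  assumes "\<not> int p dvd a"
  obtains b where "[a * b = 1] (mod int p)"
proof -
  have "coprime a (int p)"
    using assms prime_p by (metis coprime_commute prime_imp_coprime prime_nat_int_transfer)
  then show thesis using cong_solve_coprime_int that by blast
qed

lemma mod_in_units: "\<not> int p dvd t \<Longrightarrow> t mod int p \<in> {1..<int p}"
proof -
  assume "\<not> int p dvd t"
  then have "t mod int p \<noteq> 0" by (simp add: mod_eq_0_iff_dvd)
  moreover have "0 \<le> t mod int p" "t mod int p < int p" using p_gt_1 by simp_all
  ultimately show ?thesis unfolding atLeastLessThan_iff by linarith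
qed

text \<open>The set of differences to which \<open>affine_of_difference_preserving\<close> is
  applied.\<close>

definition positives :: "int set" where
  "positives = {t \<in> {1..<int p}. f t = 1}"

lemma mod_in_positives: "t mod int p \<in> positives \<longleftrightarrow> f t = 1"
proof -
  have "f (t mod int p) = f t" by (rule f_cong) (simp add: cong_def)
  moreover have "f t \<noteq> 1" if "int p dvd t" using f_zero[OF that] by simp
  ultimately show ?thesis using mod_in_units by (auto simp: positives_def)
qed

lemma positives_nonempty: "positives \<noteq> {}"
proof -
  have "f 1 = 1 \<or> f (g ^ r * 1) = 1" using f_sign[OF not_dvd_1] f_shift[of 1] by auto
  then show ?thesis using mod_in_positives by blast
qed

text \<open>Multiplication by \<open>g ^ r\<close> maps \<open>positives\<close> injectively to
  nonzero residues outside it.\<close>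

lemma card_positives: "2 * card positives < p"
proof -
  let ?m = "\<lambda>t. g ^ r * t mod int p"
  have fin: "finite positives"
    by (rule finite_subset[of _ "{1..<int p}"]) (auto simp: positives_def)
  have "inj_on ?m positives"
  proof (rule inj_onI)
    fix s t assume st: "s \<in> positives" "t \<in> positives" "?m s = ?m t"
    then have "int p dvd g ^ r * (s - t)" by (simp add: mod_eq_dvd_iff algebra_simps)
    then have "int p dvd s - t" using prime_p not_dvd_g by (simp add: prime_dvd_mult_iff)
    then have "s mod int p = t mod int p" by (simp add: mod_eq_dvd_iff)
    then show "s = t" using st by (simp add: positives_def)
  qed
  then have "card (?m ` positives) = card positives" by (rule card_image)
  moreover have "positives \<inter> ?m ` positives = {}"
    using f_shift by (auto simp: mod_in_positives) (simp add: positives_def)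
  ultimately have "2 * card positives = card (positives \<union> ?m ` positives)"
    using fin by (simp add: card_Un_disjoint)
  also have "\<dots> \<le> card {1..<int p}"
  proof (rule card_mono)
    have "?m t \<in> {1..<int p}" if "t \<in> positives" for t
    proof -
      have "\<not> int p dvd t" using that not_dvd_Zp[of t] by (simp add: positives_def)
      then have "\<not> int p dvd g ^ r * t" using prime_p not_dvd_g by (simp add: prime_dvd_mult_iff)
      then show ?thesis by (rule mod_in_units)
    qed
    then show "positives \<union> ?m ` positives \<subseteq> {1..<int p}" by (auto simp: positives_def)
  qed simp
  also have "\<dots> < p" using p_gt_1 by simp
  finally show ?thesis .
qed

text \<open>Rescaling the source by an inverse of \<open>g ^ b\<close> and the target by
  \<open>g ^ a\<close> gives a map that preserves positive differences, hence is affine. Fixing 0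
  kills the constant, and the slope is a unit, hence a power of \<open>g\<close>.\<close>

lemma pattern_preserving_is_power:
  assumes per: "\<And>x y. [x = y] (mod int p) \<Longrightarrow> [\<sigma> x = \<sigma> y] (mod int p)"
    and inj: "\<And>x y. [\<sigma> x = \<sigma> y] (mod int p) \<Longrightarrow> [x = y] (mod int p)"
    and zero: "[\<sigma> 0 = 0] (mod int p)"
    and pres: "\<And>x y. f (g ^ a * (\<sigma> y - \<sigma> x)) = f (g ^ b * (y - x))"
  obtains e where "\<And>x. [\<sigma> x = g ^ e * x] (mod int p)"
proof -
  obtain h where h: "[g ^ b * h = 1] (mod int p)" using inverse_mod_p[OF not_dvd_g] by blast
  obtain k where k: "[g ^ a * k = 1] (mod int p)" using inverse_mod_p[OF not_dvd_g] by blast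
  define \<rho> where "\<rho> x = g ^ a * \<sigma> (h * x)" for x
  have cancel: "[x = y] (mod int p)" if "[u * x = u * y] (mod int p)" "[u * v = 1] (mod int p)"
    for u v x y
  proof -
    have "[v * (u * x) = v * (u * y)] (mod int p)" using that(1) by (rule cong_scalar_left)
    moreover have "[v * (u * z) = z] (mod int p)" for z
      using cong_scalar_right[OF that(2), of z] by (simp add: mult_ac)
    ultimately show ?thesis by (meson cong_sym cong_trans)
  qed
  have hg: "[h * g ^ b = 1] (mod int p)" using h by (simp add: mult.commute)
  have "\<exists>c d. \<forall>x. [\<rho> x = c * x + d] (mod int p)"
  proof (rule affine_of_difference_preserving[OF prime_p, of \<rho> positives])
    show "[\<rho> x = \<rho> y] (mod int p)" if "[x = y] (mod int p)" for x y
      unfolding \<rho>_def using that by (intro cong_scalar_left per)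
    show "[x = y] (mod int p)" if "[\<rho> x = \<rho> y] (mod int p)" for x y
      using cancel[OF inj[OF cancel[OF that[unfolded \<rho>_def] k]] hg] .
    show "positives \<subseteq> {1..<int p}" by (auto simp: positives_def)
    show "(\<rho> y - \<rho> x) mod int p \<in> positives" if "(y - x) mod int p \<in> positives" for x y
    proof -
      have "f (\<rho> y - \<rho> x) = f (g ^ a * (\<sigma> (h * y) - \<sigma> (h * x)))"
        by (simp add: \<rho>_def right_diff_distrib)
      also have "\<dots> = f (g ^ b * h * (y - x))" by (subst pres) (simp add: algebra_simps)
      also have "\<dots> = f (y - x)"
        by (rule f_cong) (use cong_scalar_right[OF h, of "y - x"] in simp)
      finally show ?thesis using that by (simp add: mod_in_positives)
    qed
  qed (use positives_nonempty card_positives in auto)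
  then obtain c d where cd: "\<And>x. [\<rho> x = c * x + d] (mod int p)" by blast
  have "[\<rho> 0 = 0] (mod int p)" unfolding \<rho>_def using cong_scalar_left[OF zero, of "g ^ a"] by simp
  then have d: "[d = 0] (mod int p)" using cd[of 0] by (simp add: cong_def)
  define c' where "c' = k * c * g ^ b"
  have \<sigma>_c': "[\<sigma> x = c' * x] (mod int p)" for x
  proof (rule cancel[OF _ k])
    have "[h * (g ^ b * x) = x] (mod int p)"
      using cong_scalar_right[OF hg, of x] by (simp add: mult_ac)
    then have "[g ^ a * \<sigma> x = \<rho> (g ^ b * x)] (mod int p)"
      unfolding \<rho>_def by (intro cong_scalar_left per) (rule cong_sym)
    also have "[\<rho> (g ^ b * x) = c * (g ^ b * x) + d] (mod int p)" by (rule cd)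
    also have "[c * (g ^ b * x) + d = c * (g ^ b * x) + 0] (mod int p)"
      using d by (intro cong_add) auto
    also have "[c * (g ^ b * x) + 0 = g ^ a * (c' * x)] (mod int p)"
      using cong_sym[OF cong_scalar_right[OF k, of "c * (g ^ b * x)"]] by (simp add: c'_def mult_ac)
    finally show "[g ^ a * \<sigma> x = g ^ a * (c' * x)] (mod int p)" .
  qed
  have "\<not> int p dvd c'"
  proof
    assume "int p dvd c'"
    then have "[c' * 1 = 0] (mod int p)" by (simp add: cong_0_iff)
    then have "[\<sigma> 1 = \<sigma> 0] (mod int p)" using \<sigma>_c'[of 1] zero by (meson cong_sym cong_trans)
    then have "[1 = 0] (mod int p)" by (rule inj)
    then show False using not_dvd_1 by (simp add: cong_0_iff)
  qed
  then obtain e where "[c' = g ^ e] (mod int p)" using generator by blast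
  then have "[\<sigma> x = g ^ e * x] (mod int p)" for x
    using \<sigma>_c'[of x] cong_scalar_right cong_trans by blast
  then show thesis by (rule that)
qed

lemma not_schurian_colour: "\<not> schurian G (int_span (indicator ` colour_classes G col))"
proof
  assume sch: "schurian G (int_span (indicator ` colour_classes G col))"
  interpret Q: group Q8 by (rule group_Q8)
  have z0: "0 \<in> Z\<^sub>p" using p_gt_1 by simp
  have unit: "(s, u) \<in> carrier Q8" if "s \<in> {1, - 1}" for s u using that by (simp add: carrier_Q8)
  have inG: "(q, s) \<in> carrier G" if "q \<in> carrier Q8" "s \<in> Z\<^sub>p" for q s
    using that unfolding carrier_G by simp
  \<comment> \<open>At residue 0 the sign functions vanish, so i and -i share a colour for both
    values of \<open>r\<close>.\<close>
  obtain \<kappa> where bij: "bij_betw \<kappa> (carrier G) (carrier G)" and \<kappa>1: "\<kappa> \<one>\<^bsub>G\<^esub> = \<one>\<^bsub>G\<^esub>"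
    and \<kappa>i: "\<kappa> ((1, Qi), 0) = ((- 1, Qi), 0)"
    and col_\<kappa>: "\<And>x y. x \<in> carrier G \<Longrightarrow> y \<in> carrier G \<Longrightarrow>
      col (\<kappa> y \<otimes>\<^bsub>G\<^esub> inv\<^bsub>G\<^esub> (\<kappa> x)) = col (y \<otimes>\<^bsub>G\<^esub> inv\<^bsub>G\<^esub> x)"
  proof (rule schurian_colouring_permutation[OF group_G finite_G sch,
      of "((1, Qi), 0)" "((- 1, Qi), 0)"])
    show "((1, Qi), 0) \<in> carrier G" "((- 1, Qi), 0) \<in> carrier G"
      using inG unit z0 by auto
    show "col ((1, Qi), 0) = col ((- 1, Qi), 0)" by (simp add: col_def cls_def phi_0)
  qed blast
  define \<pi> where "\<pi> q = fst (\<kappa> (q, 0))" for q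
  define \<rho> where "\<rho> t = snd (\<kappa> ((1, Q1), t))" for t
  have closed: "fst (\<kappa> (q, s)) \<in> carrier Q8" "snd (\<kappa> (q, s)) \<in> Z\<^sub>p"
    if "q \<in> carrier Q8" "s \<in> Z\<^sub>p" for q s
    using bij_betwE[OF bij] inG[OF that] unfolding carrier_G by (metis mem_Times_iff)+
  have rel: "cls (fst (\<kappa> (q', s')) \<otimes>\<^bsub>Q8\<^esub> inv\<^bsub>Q8\<^esub> fst (\<kappa> (q, s))) = cls (q' \<otimes>\<^bsub>Q8\<^esub> inv\<^bsub>Q8\<^esub> q)"
    "(snd (\<kappa> (q', s')) - snd (\<kappa> (q, s))) mod int p = 0 \<longleftrightarrow> (s' - s) mod int p = 0"
    "\<phi> (fst (\<kappa> (q', s')) \<otimes>\<^bsub>Q8\<^esub> inv\<^bsub>Q8\<^esub> fst (\<kappa> (q, s))) (snd (\<kappa> (q', s')) - snd (\<kappa> (q, s)))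
      = \<phi> (q' \<otimes>\<^bsub>Q8\<^esub> inv\<^bsub>Q8\<^esub> q) (s' - s)"
    if q: "q \<in> carrier Q8" "s \<in> Z\<^sub>p" and q': "q' \<in> carrier Q8" "s' \<in> Z\<^sub>p" for q s q' s'
  proof -
    have "\<kappa> (q', s') \<otimes>\<^bsub>G\<^esub> inv\<^bsub>G\<^esub> (\<kappa> (q, s))
      = (fst (\<kappa> (q', s')) \<otimes>\<^bsub>Q8\<^esub> inv\<^bsub>Q8\<^esub> fst (\<kappa> (q, s)), (snd (\<kappa> (q', s')) - snd (\<kappa> (q, s))) mod int p)"
      using quotient_G(2)[OF closed[OF q]] by (metis prod.collapse)
    then have "col (fst (\<kappa> (q', s')) \<otimes>\<^bsub>Q8\<^esub> inv\<^bsub>Q8\<^esub> fst (\<kappa> (q, s)), (snd (\<kappa> (q', s')) - snd (\<kappa> (q, s))) mod int p)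
      = col (q' \<otimes>\<^bsub>Q8\<^esub> inv\<^bsub>Q8\<^esub> q, (s' - s) mod int p)"
      using col_\<kappa>[OF inG[OF q] inG[OF q']] quotient_G(2)[OF q] by metis
    then show "cls (fst (\<kappa> (q', s')) \<otimes>\<^bsub>Q8\<^esub> inv\<^bsub>Q8\<^esub> fst (\<kappa> (q, s))) = cls (q' \<otimes>\<^bsub>Q8\<^esub> inv\<^bsub>Q8\<^esub> q)"
      "(snd (\<kappa> (q', s')) - snd (\<kappa> (q, s))) mod int p = 0 \<longleftrightarrow> (s' - s) mod int p = 0"
      "\<phi> (fst (\<kappa> (q', s')) \<otimes>\<^bsub>Q8\<^esub> inv\<^bsub>Q8\<^esub> fst (\<kappa> (q, s))) (snd (\<kappa> (q', s')) - snd (\<kappa> (q, s)))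
        = \<phi> (q' \<otimes>\<^bsub>Q8\<^esub> inv\<^bsub>Q8\<^esub> q) (s' - s)"
      unfolding col_def by (simp_all add: phi_mod)
  qed
  \<comment> \<open>Label 1 belongs to the identity alone, so equal first components stay equal;
    with the flag doing the same for second components, \<open>\<kappa>\<close> splits as a
    product.\<close>
  have fst_\<kappa>: "fst (\<kappa> (q, s)) = \<pi> q" if "q \<in> carrier Q8" "s \<in> Z\<^sub>p" for q s
  proof -
    have c: "fst (\<kappa> (q, s)) \<in> carrier Q8" "\<pi> q \<in> carrier Q8"
      using closed that z0 by (auto simp: \<pi>_def)
    have "cls (fst (\<kappa> (q, s)) \<otimes>\<^bsub>Q8\<^esub> inv\<^bsub>Q8\<^esub> \<pi> q) = cls \<one>\<^bsub>Q8\<^esub>"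
      using rel(1)[of q 0 q s] that z0 by (simp add: \<pi>_def)
    then have "cls (fst (\<kappa> (q, s)) \<otimes>\<^bsub>Q8\<^esub> inv\<^bsub>Q8\<^esub> \<pi> q) = 1" by (simp add: cls_def one_Q8)
    then have "fst (\<kappa> (q, s)) \<otimes>\<^bsub>Q8\<^esub> inv\<^bsub>Q8\<^esub> \<pi> q = \<one>\<^bsub>Q8\<^esub>"
      using c by (subst (asm) cls_eq_1) (auto simp: one_Q8)
    then show ?thesis using c by (metis Q.inv_closed Q.inv_equality Q.inv_inv)
  qed
  have snd_\<kappa>: "snd (\<kappa> (q, s)) = \<rho> s" if "q \<in> carrier Q8" "s \<in> Z\<^sub>p" for q s
  proof -
    have "(snd (\<kappa> (q, s)) - \<rho> s) mod int p = 0"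
      using rel(2)[of "(1, Q1)" s q s] that unit by (simp add: \<rho>_def)
    then have "snd (\<kappa> (q, s)) mod int p = \<rho> s mod int p" by (simp add: mod_eq_dvd_iff mod_eq_0_iff_dvd)
    then show ?thesis using closed[OF that] closed[of "(1, Q1)" s] unit that(2) by (simp add: \<rho>_def)
  qed
  \<comment> \<open>The periodic extension of \<open>\<rho>\<close> to all integers.\<close>
  define \<sigma> where "\<sigma> x = \<rho> (x mod int p)" for x
  have md: "x mod int p \<in> Z\<^sub>p" for x using p_gt_1 by simp
  have E: "\<phi> (\<pi> q' \<otimes>\<^bsub>Q8\<^esub> inv\<^bsub>Q8\<^esub> \<pi> q) (\<sigma> y - \<sigma> x) = \<phi> (q' \<otimes>\<^bsub>Q8\<^esub> inv\<^bsub>Q8\<^esub> q) (y - x)"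
    if "q \<in> carrier Q8" "q' \<in> carrier Q8" for q q' x y
  proof -
    have "\<phi> (\<pi> q' \<otimes>\<^bsub>Q8\<^esub> inv\<^bsub>Q8\<^esub> \<pi> q) (\<sigma> y - \<sigma> x) = \<phi> (q' \<otimes>\<^bsub>Q8\<^esub> inv\<^bsub>Q8\<^esub> q) (y mod int p - x mod int p)"
      using rel(3)[OF that(1) md[of x] that(2) md[of y]]
      unfolding fst_\<kappa>[OF that(1) md] fst_\<kappa>[OF that(2) md] snd_\<kappa>[OF that(1) md]
        snd_\<kappa>[OF that(2) md] \<sigma>_def .
    also have "\<dots> = \<phi> (q' \<otimes>\<^bsub>Q8\<^esub> inv\<^bsub>Q8\<^esub> q) (y - x)"
      by (rule phi_cong) (simp add: cong_def mod_simps)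
    finally show ?thesis .
  qed
  have cls_\<pi>: "cls (\<pi> q' \<otimes>\<^bsub>Q8\<^esub> inv\<^bsub>Q8\<^esub> \<pi> q) = cls (q' \<otimes>\<^bsub>Q8\<^esub> inv\<^bsub>Q8\<^esub> q)"
    if "q \<in> carrier Q8" "q' \<in> carrier Q8" for q q'
    using rel(1)[OF that(1) z0 that(2) z0] by (simp add: \<pi>_def)
  have \<pi>_closed: "\<pi> q \<in> carrier Q8" if "q \<in> carrier Q8" for q
    using closed[OF that z0] by (simp add: \<pi>_def)
  have \<pi>1: "\<pi> (1, Q1) = (1, Q1)" and \<rho>0: "\<rho> 0 = 0"
    using \<kappa>1 by (simp_all add: \<pi>_def \<rho>_def one_Q8)
  have \<pi>i: "\<pi> (1, Qi) = (- 1, Qi)" using \<kappa>i by (simp add: \<pi>_def)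
  have inv1: "inv\<^bsub>Q8\<^esub> (1, Q1) = (1, Q1)" by (simp add: inv_Q8)
  have r1: "q \<otimes>\<^bsub>Q8\<^esub> (1, Q1) = q" if "q \<in> carrier Q8" for q
    using Q.r_one[OF that] by (simp add: one_Q8)
  \<comment> \<open>k is active for both values of \<open>r\<close>, so its image is active too, and
    comparing their sign functions determines \<open>\<rho>\<close>.\<close>
  define w where "w = \<pi> (1, Qk)"
  have w: "w \<in> carrier Q8" unfolding w_def using \<pi>_closed unit by simp
  have wa: "active (snd w)"
    using cls_\<pi>[of "(1, Q1)" "(1, Qk)"] unit cls_eq_3[OF w] r1[OF w]
    by (simp add: w_def[symmetric] \<pi>1 inv1 mult_Q8 cls_def)
  obtain e where e: "\<And>x. [\<sigma> x = g ^ e * x] (mod int p)"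
  proof (rule pattern_preserving_is_power[of \<sigma> "expo w" "expo (1, Qk)"])
    show "[\<sigma> x = \<sigma> y] (mod int p)" if "[x = y] (mod int p)" for x y
      using that by (simp add: \<sigma>_def cong_def)
    show "[x = y] (mod int p)" if "[\<sigma> x = \<sigma> y] (mod int p)" for x y
    proof -
      have "\<kappa> ((1, Q1), s) = (\<pi> (1, Q1), \<rho> s)" if "s \<in> Z\<^sub>p" for s
        using fst_\<kappa>[OF unit that] snd_\<kappa>[OF unit that] by (metis insertI1 prod.collapse)
      moreover have "\<rho> (x mod int p) = \<rho> (y mod int p)"
      proof -
        have "\<rho> s \<in> Z\<^sub>p" if "s \<in> Z\<^sub>p" for s using closed[of "(1, Q1)" s] unit that by (simp add: \<rho>_def)
        then show ?thesis using that md by (simp add: \<sigma>_def cong_def)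
      qed
      ultimately have "\<kappa> ((1, Q1), x mod int p) = \<kappa> ((1, Q1), y mod int p)" using md by simp
      then have "((1 :: int, Q1), x mod int p) = ((1, Q1), y mod int p)"
        by (rule inj_onD[OF bij_betw_imp_inj_on[OF bij]]) (rule inG[OF unit md], simp)+
      then show ?thesis by (simp add: cong_def)
    qed
    show "[\<sigma> 0 = 0] (mod int p)" by (simp add: \<sigma>_def \<rho>0)
    show "f (g ^ expo w * (\<sigma> y - \<sigma> x)) = f (g ^ expo (1, Qk) * (y - x))" for x y
      using E[of "(1, Q1)" "(1, Qk)" y x] unit phi_expo[OF w wa] phi_expo[of "(1, Qk)"] r1[OF w]
      by (simp add: w_def[symmetric] \<pi>1 inv1 mult_Q8)
  qed blast
  \<comment> \<open>On exponents of quotients, passing to the images subtracts the constant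
    \<open>e\<close>.\<close>
  have shift: "[expo (\<pi> q' \<otimes>\<^bsub>Q8\<^esub> inv\<^bsub>Q8\<^esub> \<pi> q) + e = expo (q' \<otimes>\<^bsub>Q8\<^esub> inv\<^bsub>Q8\<^esub> q)] (mod 2 * r)"
    if q: "q \<in> carrier Q8" "q' \<in> carrier Q8" and act: "active (snd (q' \<otimes>\<^bsub>Q8\<^esub> inv\<^bsub>Q8\<^esub> q))" for q q'
  proof (rule f_distinct, rule allI)
    fix t
    let ?y = "q' \<otimes>\<^bsub>Q8\<^esub> inv\<^bsub>Q8\<^esub> q" and ?z = "\<pi> q' \<otimes>\<^bsub>Q8\<^esub> inv\<^bsub>Q8\<^esub> \<pi> q"
    have c: "?y \<in> carrier Q8" "?z \<in> carrier Q8" using q \<pi>_closed by auto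
    then have act': "active (snd ?z)" using act cls_\<pi>[OF q] cls_eq_3 by metis
    have "f (g ^ (expo ?z + e) * t) = \<phi> ?z (g ^ e * t)"
      using phi_expo[OF c(2) act'] by (simp add: power_add mult.assoc)
    also have "\<dots> = \<phi> ?z (\<sigma> t - \<sigma> 0)"
      by (rule phi_cong) (use cong_sym[OF e[of t]] \<rho>0 in \<open>simp add: \<sigma>_def\<close>)
    also have "\<dots> = f (g ^ expo ?y * t)" using E[OF q, of t 0] phi_expo[OF c(1) act] by simp
    finally show "f (g ^ (expo ?z + e) * t) = f (g ^ expo ?y * t)" .
  qed
  have k1: "[expo w + e = 2] (mod 2 * r)"
    using shift[of "(1, Q1)" "(1, Qk)"] unit r1[OF w]
    by (simp add: w_def[symmetric] \<pi>1 inv1 mult_Q8 expo_def)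
  \<comment> \<open>The quotient of k by i is -j, with exponent \<open>1 + r\<close>; as i goes to
    -i, the quotient of the images is \<open>w\<close> times i.\<close>
  have ki: "[expo (w \<otimes>\<^bsub>Q8\<^esub> (1, Qi)) + e = 1 + r] (mod 2 * r)"
    using shift[of "(1, Qi)" "(1, Qk)"] unit
    by (simp add: w_def[symmetric] \<pi>i inv_Q8 mult_Q8 expo_def)
  show False
  proof (cases "odd r")
    case True
    then have r: "2 * r = 6" "1 + r = 4" using r_cases by auto
    have ex: "expo q = unit_index (snd q) + (if fst q = 1 then 0 else 3)" for q
      using r unfolding expo_def by simp
    \<comment> \<open>Since i is active, its image -i forces \<open>e\<close> to be 3 modulo 6. Then
      k must go to -k, but -k times i is -j with exponent 4, where 1 is required.\<close>
    have "[expo (- 1, Qi) + e = expo (1, Qi)] (mod 2 * r)"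
      using shift[of "(1, Q1)" "(1, Qi)"] unit True by (simp add: \<pi>1 \<pi>i inv1 mult_Q8)
    then have "(3 + e) mod 6 = 0" unfolding r ex by (simp add: cong_def)
    moreover have "(expo w + e) mod 6 = 2" "(expo (w \<otimes>\<^bsub>Q8\<^esub> (1, Qi)) + e) mod 6 = 4"
      using k1 ki unfolding r by (simp_all add: cong_def)
    ultimately have "expo w mod 6 = 5" "expo (w \<otimes>\<^bsub>Q8\<^esub> (1, Qi)) mod 6 = 1" by presburger+
    moreover have "expo w mod 6 = 5 \<longrightarrow> expo (w \<otimes>\<^bsub>Q8\<^esub> (1, Qi)) = 4"
      using w by (rule carrier_Q8_cases) (simp_all add: mult_Q8 ex)
    ultimately show False by simp
  next
    case False
    then have r: "2 * r = 4" "1 + r = 3" using r_cases by auto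
    have ex: "expo q = unit_index (snd q) + (if fst q = 1 then 0 else 2)" for q
      using r unfolding expo_def by simp
    \<comment> \<open>Here i is inactive, so \<open>e\<close> is eliminated instead: right
      multiplication of \<open>w\<close> by i would have to raise the exponent by 1 modulo 4,
      whereas it lowers it by 1.\<close>
    have "(expo w + e) mod 4 = 2" "(expo (w \<otimes>\<^bsub>Q8\<^esub> (1, Qi)) + e) mod 4 = 3"
      using k1 ki unfolding r by (simp_all add: cong_def)
    moreover have "snd w = Qj \<or> snd w = Qk" using wa False by (cases "snd w") auto
    then have "(expo (w \<otimes>\<^bsub>Q8\<^esub> (1, Qi)) + 1) mod 4 = expo w mod 4"
      using w by (elim carrier_Q8_cases) (auto simp: mult_Q8 ex)
    ultimately show False by presburger
  qed
qed

end

theorem proposition4p1: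
  fixes p :: nat
  assumes "prime p" and "[p = 1] (mod 4) \<or> [p = 1] (mod 6)"
  shows "\<not> schur_group (Q8 \<times>\<times> integer_mod_group p)"
proof -
  have p: "p > 1" using assms(1) prime_gt_1_nat by blast
  have "\<exists>r. (r = 2 \<or> r = 3) \<and> 2 * r dvd p - 1"
    using assms(2)
  proof
    assume "[p = 1] (mod 4)"
    then have "4 dvd p - 1" using p by (simp add: cong_altdef_nat cong_sym_eq)
    then show ?thesis by (intro exI[of _ 2]) simp
  next
    assume "[p = 1] (mod 6)"
    then have "6 dvd p - 1" using p by (simp add: cong_altdef_nat cong_sym_eq)
    then show ?thesis by (intro exI[of _ 3]) simp
  qed
  then obtain r where r: "r = 2 \<or> r = 3" "2 * r dvd p - 1" by blast
  then have "r > 0" by auto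
  obtain g f where "sign_pattern p r g f"
    by (rule sign_pattern_exists[OF assms(1) r(2) \<open>r > 0\<close>])
  then interpret quaternion_pattern p r g f
    using r(1) by (simp add: quaternion_pattern_def quaternion_pattern_axioms_def)
  show ?thesis unfolding schur_group_def using s_ring_colour not_schurian_colour by blast
qed

end
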